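(* Let $n\geq1$ and $p\in(0,1)$ be fixed, and let $r=r(m)$ be integers such that $r/m$ stays in a fixed compact subinterval of $(0,1)$. As $m\to\infty$, we have \[P_{n,m,r}(p)=\left[\frac12\,\mathrm{erfc}\!\left(\sqrt{m}\,\rho\!\left(\tfrac{r}{m},\tfrac{p}{1-p}\right)\right)+\frac{A\!\left(\tfrac{r}{m},\tfrac{p}{1-p}\right)}{\sqrt{2m\pi}}\,e^{-m\rho\left(\frac{r}{m},\frac{p}{1-p}\right)^2}\right]^n(1+o(1)).\]
   Context: A word in $C_m\wr S_n$ has $mn$ positions, divided into $n$ blocks of $m$ positions each. Each position is independently in error with probability $p$. $P_{n,m,r}(p)$ is the probability that the error pattern (the set of positions in error) is correctible, i.e. that it contains at most $r$ errors in each block. The complementary error function is $\mathrm{erfc}(x)=\frac{2}{\sqrt{\pi}}\int_x^\infty e^{-t^2}\,dt$. Define, for $\beta\in(0,1)$ and $x>0$, \[\rho(\beta,x)=\sqrt{\log(1+x)-\beta\log x-h(\beta)},\qquad h(\beta)=-\beta\log\beta-(1-\beta)\log(1-\beta),\] \[A(\beta,x)=\frac{1}{\sqrt{\beta(1-\beta)}\left(1-\frac{\beta}{x(1-\beta)}\right)}-\frac{1}{\sqrt2\,\rho(\beta,x)}.\] The radicand in $\rho(\beta,x)$ has a quadratic zero at $x=\beta/(1-\beta)$, and the sign of the square root is chosen so that $\rho(\beta,x)$ is analytic in $x$ near that point, with $\rho(\beta,x)>0$ for $x>\beta/(1-\beta)$ and $\rho(\beta,x)<0$ for $0<x<\beta/(1-\beta)$.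 $A(\beta,x)$ is extended by continuity at $x=\beta/(1-\beta)$. *)

theory Defs
  imports "HOL-Probability.Probability" "HOL-Library.Landau_Symbols"
begin

text \<open>Position \<open>(i, j)\<close> is the \<open>j\<close>-th position of the \<open>i\<close>-th block.\<close>

definition positions :: "nat \<Rightarrow> nat \<Rightarrow> (nat \<times> nat) set" where
  "positions n m = {..<n} \<times> {..<m}"

definition error_pattern_pmf :: "nat \<Rightarrow> nat \<Rightarrow> real \<Rightarrow> (nat \<times> nat) set pmf" where
  "error_pattern_pmf n m p =
     map_pmf (\<lambda>e. {z \<in> positions n m. e z}) (Pi_pmf (positions n m) False (\<lambda>_. bernoulli_pmf p))"

definition correctible :: "nat \<Rightarrow> nat \<Rightarrow> nat \<Rightarrow> (nat \<times> nat) set \<Rightarrow> bool" where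
  "correctible n m r E \<longleftrightarrow> (\<forall>i<n. card {j. j < m \<and> (i, j) \<in> E} \<le> r)"

definition P_correct :: "nat \<Rightarrow> nat \<Rightarrow> nat \<Rightarrow> real \<Rightarrow> real" where
  "P_correct n m r p = measure_pmf.prob (error_pattern_pmf n m p) {E. correctible n m r E}"

definition erfc :: "real \<Rightarrow> real" where
  "erfc x = 2 / sqrt pi * (LBINT t:{x..}. exp (- (t\<^sup>2)))"

definition h :: "real \<Rightarrow> real" where
  "h \<beta> = - \<beta> * ln \<beta> - (1 - \<beta>) * ln (1 - \<beta>)"

text \<open>The radicand is nonnegative with a double zero at \<open>x = \<beta> / (1 - \<beta>)\<close>; the factor \<open>sgn\<close>
  selects the branch of the square root that is analytic there and positive to the right.\<close>

definition \<rho> :: "real \<Rightarrow> real \<Rightarrow> real" where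
  "\<rho> \<beta> x = sgn (x - \<beta> / (1 - \<beta>)) * sqrt (ln (1 + x) - \<beta> * ln x - h \<beta>)"

definition A_formula :: "real \<Rightarrow> real \<Rightarrow> real" where
  "A_formula \<beta> x =
     1 / (sqrt (\<beta> * (1 - \<beta>)) * (1 - \<beta> / (x * (1 - \<beta>)))) - 1 / (sqrt 2 * \<rho> \<beta> x)"

text \<open>Both terms of \<open>A_formula\<close> have a pole at \<open>x = \<beta> / (1 - \<beta>)\<close>, and the poles cancel; the
  value there is the limit.\<close>

definition A :: "real \<Rightarrow> real \<Rightarrow> real" where
  "A \<beta> x =
     (if x = \<beta> / (1 - \<beta>) then Lim (at x) (A_formula \<beta>) else A_formula \<beta> x)"

end

theory Submission
  imports Defs
begin

text \<open>Errors in different blocks are independent, so the probability in question is \<open>S(p) ^ n\<close>, where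
  \<open>S(t)\<close> is the probability that a binomial variable with parameters \<open>m, t\<close> is at most \<open>r\<close>. Since
  a factor \<open>1 + o(1)\<close> survives a fixed power, everything comes down to \<open>n = 1\<close>, with an error bound that
  depends on \<open>\<beta> = r / m\<close> only through a distance \<open>\<eta>\<close> of \<open>\<beta>\<close> from \<open>0\<close> and \<open>1\<close>.

  Put \<open>D(t) = \<rho>\<^sup>2\<close>, which is the relative entropy of the distributions with parameters \<open>\<beta>\<close> and \<open>t\<close>;
  its derivative is \<open>(t - \<beta>) / (t (1 - t))\<close>. Both sides are regarded as functions of \<open>t\<close>, and
  their derivatives are compared. The derivative of \<open>S\<close> is a constant times \<open>exp (- m D) / (1 - t)\<close>.
  If \<open>B\<close> denotes the approximation by \<open>erfc\<close> and \<open>A\<close>, then the function \<open>A\<close> is exactly the one for which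
  the terms of leading order in \<open>B'\<close> collapse to the same expression, so that
  \<open>(B - S / s)' = A'(t) exp (- m D) / sqrt (2 \<pi> m)\<close>, where \<open>s\<close> is the quotient of
  \<open>m choose r\<close> by its value according to Stirling's formula (\<open>err_deriv\<close>).

  The one estimate with content is \<open>\<bar>A'(t)\<bar> \<le> K / (t (1 - t))\<close>, uniformly in \<open>\<beta>\<close>
  (\<open>amplitude_slope_bound\<close>): the double poles of the two terms of \<open>A'\<close> at \<open>t = \<beta>\<close> cancel completely.
  It says that, away from \<open>t = 0\<close>, the error changes at most \<open>O(1 / m)\<close> times as fast as \<open>S\<close> itself.
  Since the error and \<open>S\<close> both vanish at \<open>t = 1\<close>, this bounds the error by \<open>O(S / m)\<close> for \<open>t > \<beta>\<close>, also
  where \<open>S\<close> is exponentially small (\<open>err_right\<close>). At \<open>t = \<beta>\<close> boundedness of \<open>A\<close> gives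
  \<open>S / s = 1 / 2 + O(1 / sqrt m)\<close> (\<open>err_center\<close>), and the comparison then continues down to \<open>t = 0\<close>
  (\<open>err_left\<close>). There \<open>S = 1\<close> and \<open>B\<close> tends to \<open>1\<close>, which forces \<open>s = 1 + O(1 / sqrt m)\<close>: Stirling's
  formula is a by-product of the total mass being \<open>1\<close>, with the uniformity in \<open>r\<close> that is needed here.

  Finally, when \<open>r / m\<close> happens to equal \<open>p\<close>, the value of \<open>A\<close> is one and the same number for all such
  \<open>m\<close>, so that its term is \<open>O(1 / sqrt m)\<close> and all that matters is \<open>S = 1 / 2 + O(1 / sqrt m)\<close>.\<close>

section \<open>Reduction to one block\<close>

text \<open>Passing to the Boolean images of the two components makes the event a product of countable sets; the
  component types themselves may be uncountable, as they are for error patterns below.\<close>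
lemma prob_pair_pmf_conj:
  "measure_pmf.prob (pair_pmf M N) {z. Q (fst z) \<and> R (snd z)} =
     measure_pmf.prob M {x. Q x} * measure_pmf.prob N {y. R y}"
proof -
  have "{z. Q (fst z) \<and> R (snd z)} = (\<lambda>(x, y). (Q x, R y)) -` ({True} \<times> {True})"
    by auto
  then have "measure_pmf.prob (pair_pmf M N) {z. Q (fst z) \<and> R (snd z)} =
      measure_pmf.prob (pair_pmf (map_pmf Q M) (map_pmf R N)) ({True} \<times> {True})"
    by (simp add: map_pair[symmetric])
  also have "\<dots> = measure_pmf.prob (map_pmf Q M) {True} * measure_pmf.prob (map_pmf R N) {True}"
    by (rule measure_pmf_prob_product) auto
  also have "\<dots> = measure_pmf.prob M {x. Q x} * measure_pmf.prob N {y. R y}"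
    by (simp add: vimage_def)
  finally show ?thesis .
qed

definition binomial_cdf :: "nat \<Rightarrow> nat \<Rightarrow> real \<Rightarrow> real" where
  "binomial_cdf m r t = (\<Sum>k\<le>r. real (m choose k) * t ^ k * (1 - t) ^ (m - k))"

lemma prob_block_correctible:
  fixes i :: nat
  assumes p: "0 \<le> p" "p \<le> 1"
  shows "measure_pmf.prob (Pi_pmf ({i} \<times> {..<m}) False (\<lambda>_. bernoulli_pmf p))
           {e. card {j. j < m \<and> e (i, j)} \<le> r} = binomial_cdf m r p"
proof -
  let ?M = "Pi_pmf ({i} \<times> {..<m}) False (\<lambda>_. bernoulli_pmf p)"
  have card_eq: "card {z \<in> {i} \<times> {..<m}. e z} = card {j. j < m \<and> e (i, j)}" for e :: "nat \<times> nat \<Rightarrow> bool"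
  proof -
    have "{z \<in> {i} \<times> {..<m}. e z} = Pair i ` {j. j < m \<and> e (i, j)}"
      by auto
    then show ?thesis
      by (simp add: card_image inj_on_def)
  qed
  have "binomial_pmf m p = map_pmf (\<lambda>e. card {z \<in> {i} \<times> {..<m}. e z}) ?M"
    by (rule binomial_pmf_altdef') (use p in auto)
  then have "measure_pmf.prob (binomial_pmf m p) {..r} =
      measure_pmf.prob ?M {e. card {j. j < m \<and> e (i, j)} \<le> r}"
    by (simp add: card_eq vimage_def)
  moreover have "measure_pmf.prob (binomial_pmf m p) {..r} = binomial_cdf m r p"
    using p by (simp add: measure_measure_pmf_finite binomial_cdf_def)
  ultimately show ?thesis
    by simp
qed

lemma P_correct_eq_power:
  assumes p: "0 \<le> p" "p \<le> 1"
  shows "P_correct n m r p = binomial_cdf m r p ^ n"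
proof -
  let ?M = "\<lambda>S. Pi_pmf S False (\<lambda>_. bernoulli_pmf p)"
  let ?good = "\<lambda>n (e :: nat \<times> nat \<Rightarrow> bool). \<forall>i<n. card {j. j < m \<and> e (i, j)} \<le> r"
  have "measure_pmf.prob (?M ({..<n} \<times> {..<m})) {e. ?good n e} = binomial_cdf m r p ^ n"
  proof (induction n)
    case 0
    then show ?case by simp
  next
    case (Suc n)
    let ?A = "{..<n} \<times> {..<m}" and ?B = "{n} \<times> {..<m}"
    let ?join = "\<lambda>(f, g) x. if x \<in> ?A then f x else g x"
    have split: "{..<Suc n} \<times> {..<m} = ?A \<union> ?B"
      by (auto simp: less_Suc_eq)
    have "?M ({..<Suc n} \<times> {..<m}) = map_pmf ?join (pair_pmf (?M ?A) (?M ?B))"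
      unfolding split by (rule Pi_pmf_union) auto
    moreover have "?good (Suc n) (?join z) \<longleftrightarrow>
        ?good n (fst z) \<and> card {j. j < m \<and> snd z (n, j)} \<le> r" for z
      by (cases z) (auto simp: less_Suc_eq cong: conj_cong)
    ultimately have "measure_pmf.prob (?M ({..<Suc n} \<times> {..<m})) {e. ?good (Suc n) e} =
        measure_pmf.prob (pair_pmf (?M ?A) (?M ?B))
          {z. ?good n (fst z) \<and> card {j. j < m \<and> snd z (n, j)} \<le> r}"
      by (simp add: vimage_def)
    also have "\<dots> = measure_pmf.prob (?M ?A) {e. ?good n e} *
        measure_pmf.prob (?M ?B) {e. card {j. j < m \<and> e (n, j)} \<le> r}"
      by (rule prob_pair_pmf_conj)
    finally show ?case
      using Suc prob_block_correctible[OF p] by simp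
  qed
  moreover have "correctible n m r {z \<in> positions n m. e z} \<longleftrightarrow> ?good n e" for e
    by (auto simp: correctible_def positions_def cong: conj_cong)
  ultimately show ?thesis
    by (simp add: P_correct_def error_pattern_pmf_def vimage_def) (simp add: positions_def)
qed

text \<open>The sum telescopes: raising the success probability moves mass only from the value \<open>r\<close> to \<open>r + 1\<close>
  across the threshold. This one-term derivative is what makes a comparison of derivatives feasible.\<close>
lemma binomial_cdf_deriv:
  assumes "r < m"
  shows "(binomial_cdf m r has_real_derivative
           - (real (m - r) * real (m choose r) * t ^ r * (1 - t) ^ (m - Suc r))) (at t)"
  using assms
proof (induction r)
  case 0
  show ?case
    unfolding binomial_cdf_def using 0 by (auto intro!: derivative_eq_intros)
next
  case (Suc r)
  have choose: "real (Suc r) * real (m choose Suc r) = real (m - r) * real (m choose r)"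
    using Suc_times_binomial_add binomial_absorb_comp[of m r] Suc.prems
    by (metis binomial_absorption of_nat_mult)
  \<comment> \<open>the negative part of this derivative is the claim for \<open>Suc r\<close>; the positive part cancels the induction hypothesis\<close>
  have "((\<lambda>t. real (m choose Suc r) * t ^ Suc r * (1 - t) ^ (m - Suc r)) has_real_derivative
      real (Suc r) * real (m choose Suc r) * t ^ r * (1 - t) ^ (m - Suc r)
      - real (m choose Suc r) * t ^ Suc r * (real (m - Suc r) * (1 - t) ^ (m - Suc (Suc r)))) (at t)"
    by (rule derivative_eq_intros refl)+ (simp add: algebra_simps)
  from DERIV_add[OF Suc.IH this]
  show ?case
    using Suc.prems unfolding binomial_cdf_def choose by (simp add: algebra_simps)
qed

lemma binomial_cdf_pos: 
  assumes "0 \<le> t" "t < 1"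
  shows "binomial_cdf m r t > 0"
proof -
  have "0 < (\<Sum>k\<in>{0}. real (m choose k) * t ^ k * (1 - t) ^ (m - k))"
    using assms by simp
  also have "\<dots> \<le> binomial_cdf m r t"
    unfolding binomial_cdf_def by (rule sum_mono2) (use assms in auto)
  finally show ?thesis .
qed

lemma binomial_cdf_0: "binomial_cdf m r 0 = 1"
  by (simp add: binomial_cdf_def sum.atMost_shift)

lemma binomial_cdf_1: "r < m \<Longrightarrow> binomial_cdf m r 1 = 0"
  by (simp add: binomial_cdf_def power_0_left sum.neutral)

section \<open>The complementary error function\<close>

lemma gauss_integrable: "integrable lborel (\<lambda>t::real. exp (- t\<^sup>2))"
  and gauss_integral: "(LBINT t. exp (- t\<^sup>2)) = sqrt pi"
proof -
  have "has_bochner_integral lborel (\<lambda>t::real. exp (- t\<^sup>2)) (2 * (sqrt pi / 2))"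
    using has_bochner_integral_even_function[OF gaussian_moment_0] by simp
  then show "integrable lborel (\<lambda>t::real. exp (- t\<^sup>2))" "(LBINT t. exp (- t\<^sup>2)) = sqrt pi"
    by (auto simp: has_bochner_integral_iff)
qed

lemma gauss_set_integrable: "S \<in> sets borel \<Longrightarrow> set_integrable lborel S (\<lambda>t::real. exp (- t\<^sup>2))"
  using gauss_integrable unfolding set_integrable_def
  by (intro integrable_mult_indicator) auto

lemma erfc_reflect: "erfc (- x) = 2 - erfc x"
proof -
  have "(LBINT t:{- x..}. exp (- t\<^sup>2)) = (LBINT t:{..x}. exp (- t\<^sup>2))"
    unfolding set_lebesgue_integral_def
    by (subst lborel_integral_real_affine[where c = "-1" and t = 0])
       (auto intro!: Bochner_Integration.integral_cong simp: indicator_def)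
  also have "\<dots> = (LBINT t:{..<x}. exp (- t\<^sup>2))"
  proof (rule set_integral_cong_set)
    show "AE t in lborel. (t \<in> {..<x}) = (t \<in> {..x})"
      using AE_lborel_singleton[of x] by eventually_elim auto
  qed (auto simp: set_borel_measurable_def)
  finally have "(LBINT t:{- x..}. exp (- t\<^sup>2)) + (LBINT t:{x..}. exp (- t\<^sup>2)) =
      (LBINT t:{..<x} \<union> {x..}. exp (- t\<^sup>2))"
    by (subst set_integral_Un) (auto intro: gauss_set_integrable)
  also have "{..<x} \<union> {x..} = UNIV"
    by auto
  finally show ?thesis
    using gauss_integral by (simp add: erfc_def set_lebesgue_integral_def field_simps)
qed

lemma erfc_0: "erfc 0 = 1"
  using erfc_reflect[of 0] by simp

lemma erfc_at_bot: "(erfc \<longlongrightarrow> 2) at_bot"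
proof -
  have "((\<lambda>y. LBINT t. indicator {..y} t *\<^sub>R exp (- t\<^sup>2)) \<longlongrightarrow> (LBINT t::real. exp (- t\<^sup>2))) at_top"
    by (rule tendsto_integral_at_top) (auto intro: gauss_integrable)
  then have "((\<lambda>y. 2 / sqrt pi * (LBINT t:{..y}. exp (- t\<^sup>2))) \<longlongrightarrow> 2 / sqrt pi * sqrt pi) at_top"
    unfolding gauss_integral set_lebesgue_integral_def by (intro tendsto_intros)
  moreover have "2 / sqrt pi * (LBINT t:{..y}. exp (- t\<^sup>2)) = erfc (- y)" for y
    unfolding erfc_def set_lebesgue_integral_def
    by (subst (2) lborel_integral_real_affine[where c = "-1" and t = 0])
       (auto intro!: Bochner_Integration.integral_cong simp: indicator_def)
  ultimately show ?thesis
    by (simp add: filterlim_at_bot_mirror)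
qed

lemma erfc_at_top: "(erfc \<longlongrightarrow> 0) at_top"
proof -
  have "((\<lambda>x. 2 - erfc (- x)) \<longlongrightarrow> 2 - 2) at_top"
    using erfc_at_bot by (intro tendsto_intros) (simp add: filterlim_at_bot_mirror)
  then show ?thesis
    by (simp add: erfc_reflect)
qed

lemma erfc_deriv: "(erfc has_real_derivative - (2 / sqrt pi * exp (- x\<^sup>2))) (at x)"
proof -
  let ?g = "\<lambda>t::real. exp (- t\<^sup>2)"
  have cont: "continuous_on {x - 1..x + 1} ?g"
    by (intro continuous_intros)
  have "((\<lambda>y. integral {x - 1..y} ?g) has_real_derivative ?g x) (at x within {x - 1..x + 1})"
    by (rule integral_has_real_derivative[OF cont]) auto
  then have int: "((\<lambda>y. integral {x - 1..y} ?g) has_real_derivative ?g x) (at x)"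
    by (simp add: at_within_Icc_at)
  have "((\<lambda>y. erfc (x - 1) - 2 / sqrt pi * integral {x - 1..y} ?g) has_real_derivative
      - (2 / sqrt pi * exp (- x\<^sup>2))) (at x)"
    by (rule derivative_eq_intros int refl)+ simp
  then show ?thesis
  proof (rule has_field_derivative_transform_within_open[where S = "{x - 1<..}"])
    fix y assume y: "y \<in> {x - 1<..}"
    have "(LBINT t:{x - 1..<y} \<union> {y..}. ?g t) = (LBINT t:{x - 1..<y}. ?g t) + (LBINT t:{y..}. ?g t)"
      by (rule set_integral_Un) (auto intro: gauss_set_integrable)
    also have "{x - 1..<y} \<union> {y..} = {x - 1..}"
      using y by auto
    also have "(LBINT t:{x - 1..<y}. ?g t) = (LBINT t:{x - 1..y}. ?g t)"
    proof (rule set_integral_cong_set)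
      show "AE t in lborel. (t \<in> {x - 1..y}) = (t \<in> {x - 1..<y})"
        using AE_lborel_singleton[of y] by eventually_elim auto
    qed (auto simp: set_borel_measurable_def)
    also have "\<dots> = integral {x - 1..y} ?g"
      by (rule set_borel_integral_eq_integral) (auto intro: gauss_set_integrable)
    finally show "erfc (x - 1) - 2 / sqrt pi * integral {x - 1..y} ?g = erfc y"
      by (simp add: erfc_def field_simps)
  qed auto
qed

section \<open>Relative entropy and its second-order expansion\<close>

text \<open>The Kullback-Leibler divergence of the Bernoulli distribution with parameter \<open>\<beta>\<close> from the one with
  parameter \<open>t\<close>. Written in \<open>t\<close> instead of the odds \<open>x = t / (1 - t)\<close>, it is the radicand in \<open>\<rho>\<close>.\<close>
definition rel_ent :: "real \<Rightarrow> real \<Rightarrow> real" where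
  "rel_ent \<beta> t = - \<beta> * ln t - (1 - \<beta>) * ln (1 - t) - h \<beta>"

text \<open>The Fisher information of the Bernoulli distribution, which is the second derivative of \<open>rel_ent \<beta>\<close> at \<open>\<beta>\<close>.\<close>
definition fisher :: "real \<Rightarrow> real" where
  "fisher t = 1 / (t * (1 - t))"

text \<open>Since \<open>rel_ent \<beta> t\<close> is the integral of \<open>(s - \<beta>) * fisher s\<close> over \<open>s\<close> from \<open>\<beta>\<close> to \<open>t\<close>, this is the mean of
  \<open>fisher\<close> over that segment with weights proportional to \<open>\<bar>s - \<beta>\<bar>\<close>.\<close>
definition mean_fisher :: "real \<Rightarrow> real \<Rightarrow> real" where
  "mean_fisher \<beta> t = 2 * rel_ent \<beta> t / (t - \<beta>)\<^sup>2"

lemma rel_ent_self: "rel_ent \<beta> \<beta> = 0"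
  by (simp add: rel_ent_def h_def)

lemma rel_ent_deriv:
  assumes "0 < t" "t < 1"
  shows "(rel_ent \<beta> has_real_derivative (t - \<beta>) * fisher t) (at t)"
proof -
  have "(rel_ent \<beta> has_real_derivative - \<beta> / t + (1 - \<beta>) / (1 - t)) (at t)"
    unfolding rel_ent_def[abs_def] using assms by (auto intro!: derivative_eq_intros)
  also have "- \<beta> / t + (1 - \<beta>) / (1 - t) = (t - \<beta>) * fisher t"
    using assms unfolding fisher_def by (simp add: divide_simps) (simp add: algebra_simps)
  finally show ?thesis .
qed

lemma fisher_ge_4:
  assumes "0 < t" "t < 1"
  shows "4 \<le> fisher t"
proof -
  have "4 * (t * (1 - t)) = 1 - (2 * t - 1)\<^sup>2"
    by (simp add: power2_eq_square algebra_simps)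
  then have "4 * (t * (1 - t)) \<le> 1"
    by simp
  then show ?thesis
    using assms by (simp add: fisher_def field_simps)
qed

text \<open>Integrating \<open>(s - \<beta>) * g s\<close> away from \<open>\<beta>\<close> preserves signs on both sides of \<open>\<beta>\<close>. Applied to
  differences, this turns every pointwise inequality for \<open>fisher\<close> into one for \<open>rel_ent\<close>.\<close>
lemma le_of_slope_sign:
  fixes G g :: "real \<Rightarrow> real"
  assumes "\<And>s. s \<in> closed_segment \<beta> t \<Longrightarrow> (G has_real_derivative (s - \<beta>) * g s) (at s)"
    and "\<And>s. s \<in> closed_segment \<beta> t \<Longrightarrow> 0 \<le> g s"
  shows "G \<beta> \<le> G t"
proof (cases "\<beta> \<le> t")
  case True
  then show ?thesis
  proof (rule DERIV_nonneg_imp_nondecreasing)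
    fix s assume "\<beta> \<le> s" "s \<le> t"
    then show "\<exists>y. (G has_real_derivative y) (at s) \<and> 0 \<le> y"
      using assms[of s] by (auto simp: closed_segment_eq_real_ivl)
  qed
next
  case False
  then have "t \<le> \<beta>" by simp
  then show ?thesis
  proof (rule DERIV_nonpos_imp_nonincreasing)
    fix s assume "t \<le> s" "s \<le> \<beta>"
    then show "\<exists>y. (G has_real_derivative y) (at s) \<and> y \<le> 0"
      using assms[of s] False by (auto simp: closed_segment_eq_real_ivl mult_nonpos_nonneg)
  qed
qed

lemma segment_in_unit:
  fixes \<beta> t s :: real
  assumes "0 < \<beta>" "\<beta> < 1" "0 < t" "t < 1" "s \<in> closed_segment \<beta> t"
  shows "0 < s" "s < 1"
  using assms by (auto simp: closed_segment_eq_real_ivl split: if_splits)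

text \<open>Pinsker's inequality, the integrated form of \<open>fisher_ge_4\<close>.\<close>
lemma rel_ent_ge:
  assumes "0 < \<beta>" "\<beta> < 1" "0 < t" "t < 1"
  shows "2 * (t - \<beta>)\<^sup>2 \<le> rel_ent \<beta> t"
proof -
  note unit = segment_in_unit[OF assms]
  have "rel_ent \<beta> \<beta> - 2 * (\<beta> - \<beta>)\<^sup>2 \<le> rel_ent \<beta> t - 2 * (t - \<beta>)\<^sup>2"
  proof (rule le_of_slope_sign[where G = "\<lambda>s. rel_ent \<beta> s - 2 * (s - \<beta>)\<^sup>2" and g = "\<lambda>s. fisher s - 4"])
    fix s assume s: "s \<in> closed_segment \<beta> t"
    show "((\<lambda>s. rel_ent \<beta> s - 2 * (s - \<beta>)\<^sup>2) has_real_derivative (s - \<beta>) * (fisher s - 4)) (at s)"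
      by (rule derivative_eq_intros rel_ent_deriv unit[OF s] refl)+ (simp add: algebra_simps)
    show "0 \<le> fisher s - 4"
      using fisher_ge_4 unit[OF s] by simp
  qed
  then show ?thesis
    by (simp add: rel_ent_self)
qed

lemma mean_fisher_ge_4:
  assumes "0 < \<beta>" "\<beta> < 1" "0 < t" "t < 1" "t \<noteq> \<beta>"
  shows "4 \<le> mean_fisher \<beta> t"
  using rel_ent_ge[OF assms(1-4)] assms(5) by (simp add: mean_fisher_def field_simps)

lemma fisher_taylor:
  assumes "0 < \<beta>" "\<beta> < 1" "0 < t" "t < 1"
  shows "fisher t = fisher \<beta> + (1 / (1 - \<beta>)\<^sup>2 - 1 / \<beta>\<^sup>2) * (t - \<beta>)
           + (t - \<beta>)\<^sup>2 * (1 / (t * \<beta>\<^sup>2) + 1 / ((1 - t) * (1 - \<beta>)\<^sup>2))"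
proof -
  have aux: "1 / x = 1 / y - (x - y) / y\<^sup>2 + (x - y)\<^sup>2 / (x * y\<^sup>2)" if "0 < x" "0 < y" for x y :: real
    using that by (simp add: field_simps power2_eq_square)
  have split: "fisher s = 1 / s + 1 / (1 - s)" if "0 < s" "s < 1" for s
    using that by (simp add: fisher_def field_simps)
  show ?thesis
    using aux[of t \<beta>] aux[of "1 - t" "1 - \<beta>"] assms
    by (simp add: split power2_commute[of \<beta> t] algebra_simps diff_divide_distrib)
qed

lemma near_bounds:
  assumes "0 < \<eta>" "\<eta> \<le> \<beta>" "\<beta> \<le> 1 - \<eta>" "\<bar>s - \<beta>\<bar> \<le> \<eta> / 2"
  shows "0 < s" "s < 1" "fisher s \<le> 4 / \<eta> ^ 3"
    "1 / (s * \<beta>\<^sup>2) + 1 / ((1 - s) * (1 - \<beta>)\<^sup>2) \<le> 4 / \<eta> ^ 3"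
proof -
  have s: "\<eta> / 2 \<le> s" "\<eta> / 2 \<le> 1 - s"
    using assms by (auto simp: abs_if split: if_splits)
  show s01: "0 < s" "s < 1"
    using s assms(1) by auto
  have "\<eta> \<le> 1 / 2" using assms by simp
  have a: "1 / s \<le> 2 / \<eta>" "1 / (1 - s) \<le> 2 / \<eta>"
    using s assms(1) by (simp_all add: field_simps)
  have b: "1 / \<beta>\<^sup>2 \<le> 1 / \<eta>\<^sup>2" "1 / (1 - \<beta>)\<^sup>2 \<le> 1 / \<eta>\<^sup>2"
    using assms by (auto intro!: divide_left_mono power_mono mult_pos_pos)
  have "1 / s * (1 / \<beta>\<^sup>2) \<le> 2 / \<eta> * (1 / \<eta>\<^sup>2)" "1 / (1 - s) * (1 / (1 - \<beta>)\<^sup>2) \<le> 2 / \<eta> * (1 / \<eta>\<^sup>2)"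
    using a b assms(1) s01 by (intro mult_mono; simp)+
  then show "1 / (s * \<beta>\<^sup>2) + 1 / ((1 - s) * (1 - \<beta>)\<^sup>2) \<le> 4 / \<eta> ^ 3"
    using assms(1) by (simp add: power2_eq_square power3_eq_cube)
  have "fisher s = 1 / s + 1 / (1 - s)"
    using s01 by (simp add: fisher_def field_simps)
  then have "fisher s \<le> 4 / \<eta>"
    using a by simp
  also have "\<dots> \<le> 4 / \<eta> ^ 3"
    using assms(1) \<open>\<eta> \<le> 1 / 2\<close> 
    by (intro divide_left_mono) (auto simp: power3_eq_cube mult_le_one)
  finally show "fisher s \<le> 4 / \<eta> ^ 3" .
qed

text \<open>With \<open>u\<close> the linear Taylor term of \<open>fisher\<close> at \<open>\<beta>\<close>, the weighted mean has linear term \<open>2 / 3 * u\<close>, because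
  the weight \<open>s - \<beta>\<close> has its centre of mass at two thirds of the segment. The ratio \<open>2 / 3\<close> is what later
  removes the pole of \<open>A'\<close>. All constants depend on \<open>\<eta>\<close> alone.\<close>
lemma near_expansion:
  fixes \<eta> \<beta> t :: real
  defines "k \<equiv> 4 / \<eta> ^ 3" and "w \<equiv> t - \<beta>"
  assumes \<eta>: "0 < \<eta>" "\<eta> \<le> \<beta>" "\<beta> \<le> 1 - \<eta>" and w: "w \<noteq> 0" "\<bar>w\<bar> \<le> \<eta> / 2"
  obtains u where "\<bar>u\<bar> \<le> k * \<bar>w\<bar>"
    "\<bar>fisher t - (fisher \<beta> + u)\<bar> \<le> k * w\<^sup>2"
    "\<bar>mean_fisher \<beta> t - (fisher \<beta> + 2 / 3 * u)\<bar> \<le> k * w\<^sup>2"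
    "fisher \<beta> \<le> k" "fisher t \<le> k" "mean_fisher \<beta> t \<le> k"
proof -
  define f1 where "f1 = 1 / (1 - \<beta>)\<^sup>2 - 1 / \<beta>\<^sup>2"
  define R where "R = (\<lambda>s. 1 / (s * \<beta>\<^sup>2) + 1 / ((1 - s) * (1 - \<beta>)\<^sup>2))"
  have \<beta>01: "0 < \<beta>" "\<beta> < 1" using \<eta> by auto
  note near = near_bounds[OF \<eta>, folded k_def]
  have seg: "\<bar>s - \<beta>\<bar> \<le> \<eta> / 2" if "s \<in> closed_segment \<beta> t" for s
    using that w(2) by (auto simp: w_def closed_segment_eq_real_ivl split: if_splits)
  have t: "0 < t" "t < 1" and ft: "fisher t \<le> k"
    using near(1-3)[of t] w(2) by (auto simp: w_def)
  have f\<beta>: "fisher \<beta> \<le> k"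
    using near(3)[of \<beta>] \<eta> by simp
  have taylor: "fisher s = fisher \<beta> + f1 * (s - \<beta>) + (s - \<beta>)\<^sup>2 * R s" if "0 < s" "s < 1" for s
    using fisher_taylor[OF \<beta>01 that] by (simp add: f1_def R_def)
  have R: "0 \<le> R s" "R s \<le> k" if "\<bar>s - \<beta>\<bar> \<le> \<eta> / 2" for s
    using near[OF that] \<beta>01 by (auto simp: R_def)
  have f1: "\<bar>f1\<bar> \<le> k"
  proof -
    have "1 / \<beta>\<^sup>2 \<le> 1 / \<eta>\<^sup>2" "1 / (1 - \<beta>)\<^sup>2 \<le> 1 / \<eta>\<^sup>2"
      using \<eta> by (auto intro!: divide_left_mono power_mono mult_pos_pos)
    moreover have "0 \<le> 1 / \<beta>\<^sup>2" "0 \<le> 1 / (1 - \<beta>)\<^sup>2"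
      by simp_all
    ultimately have "\<bar>f1\<bar> \<le> 1 / \<eta>\<^sup>2"
      unfolding f1_def by linarith
    also have "\<dots> \<le> k"
      using \<eta> by (simp add: k_def power2_eq_square power3_eq_cube field_simps)
    finally show ?thesis .
  qed
  \<comment> \<open>\<open>H\<close> is the remainder of \<open>rel_ent\<close> after its quadratic and cubic terms; its slope involves only \<open>R\<close>\<close>
  define H where "H = (\<lambda>s. rel_ent \<beta> s - (s - \<beta>)\<^sup>2 * (fisher \<beta> / 2 + f1 * (s - \<beta>) / 3))"
  have H_deriv: "(H has_real_derivative (s - \<beta>) * ((s - \<beta>)\<^sup>2 * R s)) (at s)"
    if "0 < s" "s < 1" for s
    unfolding H_def using that
    by (auto intro!: derivative_eq_intros rel_ent_deriv)
       (simp add: taylor[OF that] power2_eq_square field_simps)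
  have "H \<beta> \<le> H t"
    by (rule le_of_slope_sign[OF H_deriv]) (use near seg R in auto)
  moreover have "k * (\<beta> - \<beta>) ^ 4 / 4 - H \<beta> \<le> k * (t - \<beta>) ^ 4 / 4 - H t"
  proof (rule le_of_slope_sign[where G = "\<lambda>s. k * (s - \<beta>) ^ 4 / 4 - H s"
        and g = "\<lambda>s. (s - \<beta>)\<^sup>2 * (k - R s)"])
    fix s assume s: "s \<in> closed_segment \<beta> t"
    show "((\<lambda>s. k * (s - \<beta>) ^ 4 / 4 - H s) has_real_derivative (s - \<beta>) * ((s - \<beta>)\<^sup>2 * (k - R s))) (at s)"
      using near(1,2)[OF seg[OF s]]
      by (auto intro!: derivative_eq_intros H_deriv)
         (simp add: power2_eq_square power3_eq_cube field_simps)
    show "0 \<le> (s - \<beta>)\<^sup>2 * (k - R s)"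
      using R[OF seg[OF s]] by simp
  qed
  ultimately have H: "0 \<le> H t" "H t \<le> k * w ^ 4 / 4"
    by (simp_all add: H_def rel_ent_self w_def)
  have mean_fisher_eq: "mean_fisher \<beta> t - (fisher \<beta> + 2 / 3 * (f1 * w)) = 2 * H t / w\<^sup>2"
    using w(1) by (simp add: mean_fisher_def H_def w_def field_simps)
  have "2 * H t / w\<^sup>2 \<le> 2 * (k * w ^ 4 / 4) / w\<^sup>2"
    using H by (intro divide_right_mono) auto
  also have "\<dots> = k * w\<^sup>2 / 2"
    using w(1) by (simp add: power2_eq_square power4_eq_xxxx)
  also have "\<dots> \<le> k * w\<^sup>2"
  proof -
    have "0 \<le> k * w\<^sup>2" using \<eta> by (simp add: k_def)
    then show ?thesis by simp
  qed
  finally have mean_fisher_bd: "\<bar>2 * H t / w\<^sup>2\<bar> \<le> k * w\<^sup>2"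
    using H by simp
  have "k * (\<beta> - \<beta>)\<^sup>2 / 2 - rel_ent \<beta> \<beta> \<le> k * (t - \<beta>)\<^sup>2 / 2 - rel_ent \<beta> t"
  proof (rule le_of_slope_sign[where G = "\<lambda>s. k * (s - \<beta>)\<^sup>2 / 2 - rel_ent \<beta> s"
        and g = "\<lambda>s. k - fisher s"])
    fix s assume s: "s \<in> closed_segment \<beta> t"
    show "((\<lambda>s. k * (s - \<beta>)\<^sup>2 / 2 - rel_ent \<beta> s) has_real_derivative (s - \<beta>) * (k - fisher s)) (at s)"
      using near(1,2)[OF seg[OF s]]
      by (auto intro!: derivative_eq_intros rel_ent_deriv) (simp add: field_simps)
    show "0 \<le> k - fisher s"
      using near[OF seg[OF s]] by simp
  qed
  then have mean_fisher_le: "mean_fisher \<beta> t \<le> k"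
    using w(1) by (simp add: mean_fisher_def rel_ent_self w_def field_simps)
  show ?thesis
  proof (rule that[of "f1 * w"])
    show "\<bar>f1 * w\<bar> \<le> k * \<bar>w\<bar>"
      unfolding abs_mult by (intro mult_right_mono f1) simp
    have "\<bar>w\<^sup>2 * R t\<bar> \<le> w\<^sup>2 * k"
      using R[of t] w(2) by (simp add: w_def abs_mult mult_left_mono)
    then show "\<bar>fisher t - (fisher \<beta> + f1 * w)\<bar> \<le> k * w\<^sup>2"
      using taylor[OF t] by (simp add: w_def mult.commute)
    show "\<bar>mean_fisher \<beta> t - (fisher \<beta> + 2 / 3 * (f1 * w))\<bar> \<le> k * w\<^sup>2"
      unfolding mean_fisher_eq by (rule mean_fisher_bd)
  qed (fact f\<beta> ft mean_fisher_le)+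
qed

section \<open>The amplitude function in the error probability\<close>

text \<open>The function \<open>\<rho>\<close> in terms of \<open>t\<close>.\<close>
definition root_ent :: "real \<Rightarrow> real \<Rightarrow> real" where
  "root_ent \<beta> t = sgn (t - \<beta>) * sqrt (rel_ent \<beta> t)"

text \<open>The function \<open>A\<close> in terms of \<open>t\<close>. At \<open>t = \<beta>\<close> its value, a matter of division by zero, has no meaning.\<close>
definition amplitude :: "real \<Rightarrow> real \<Rightarrow> real" where
  "amplitude \<beta> t = (1 - \<beta>) / sqrt (\<beta> * (1 - \<beta>)) * (t / (t - \<beta>)) - 1 / (sqrt 2 * root_ent \<beta> t)"

lemma odds_diff:
  fixes \<beta> t :: real
  assumes "\<beta> < 1" "t < 1"
  shows "t / (1 - t) - \<beta> / (1 - \<beta>) = (t - \<beta>) / ((1 - t) * (1 - \<beta>))"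
  using assms by (simp add: field_simps)

lemma rho_odds:
  assumes "0 < \<beta>" "\<beta> < 1" "0 < t" "t < 1"
  shows "\<rho> \<beta> (t / (1 - t)) = root_ent \<beta> t"
proof -
  have "1 + t / (1 - t) = 1 / (1 - t)"
    using assms by (simp add: field_simps)
  then have "ln (1 + t / (1 - t)) - \<beta> * ln (t / (1 - t)) - h \<beta> = rel_ent \<beta> t"
    using assms by (simp add: ln_div rel_ent_def algebra_simps)
  moreover have "sgn (t / (1 - t) - \<beta> / (1 - \<beta>)) = sgn (t - \<beta>)"
    unfolding odds_diff[OF assms(2,4)] using assms by (simp add: sgn_divide sgn_mult)
  ultimately show ?thesis
    by (simp add: \<rho>_def root_ent_def)
qed

lemma A_odds:
  assumes "0 < \<beta>" "\<beta> < 1" "0 < t" "t < 1" "t \<noteq> \<beta>"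
  shows "A \<beta> (t / (1 - t)) = amplitude \<beta> t"
proof -
  have ne: "t / (1 - t) \<noteq> \<beta> / (1 - \<beta>)"
    using odds_diff[OF assms(2,4)] assms by auto
  have "1 - \<beta> / (t / (1 - t) * (1 - \<beta>)) = (t - \<beta>) / (t * (1 - \<beta>))"
    using assms by (simp add: field_simps)
  then have "1 / (sqrt (\<beta> * (1 - \<beta>)) * (1 - \<beta> / (t / (1 - t) * (1 - \<beta>))))
      = (1 - \<beta>) / sqrt (\<beta> * (1 - \<beta>)) * (t / (t - \<beta>))"
    using assms by simp
  then show ?thesis
    using ne by (simp only: A_def A_formula_def amplitude_def rho_odds[OF assms(1-4)] if_False)
qed

lemma root_ent_power2:
  assumes "0 < \<beta>" "\<beta> < 1" "0 < t" "t < 1"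
  shows "(root_ent \<beta> t)\<^sup>2 = rel_ent \<beta> t"
proof -
  have "0 \<le> rel_ent \<beta> t"
    using rel_ent_ge[OF assms] by (rule order_trans[rotated]) simp
  moreover have "t = \<beta> \<Longrightarrow> rel_ent \<beta> t = 0"
    by (simp add: rel_ent_self)
  ultimately show ?thesis
    by (cases "t = \<beta>") (simp_all add: root_ent_def power_mult_distrib sgn_real_def)
qed

lemma root_ent_mean_fisher:
  assumes "0 < \<beta>" "\<beta> < 1" "0 < t" "t < 1" "t \<noteq> \<beta>"
  shows "sqrt 2 * root_ent \<beta> t = (t - \<beta>) * sqrt (mean_fisher \<beta> t)"
proof -
  have "sqrt (mean_fisher \<beta> t) = sqrt 2 * sqrt (rel_ent \<beta> t) / \<bar>t - \<beta>\<bar>"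
    by (simp add: mean_fisher_def real_sqrt_divide real_sqrt_mult)
  then have "(t - \<beta>) * sqrt (mean_fisher \<beta> t) = (t - \<beta>) / \<bar>t - \<beta>\<bar> * (sqrt 2 * sqrt (rel_ent \<beta> t))"
    by simp
  also have "(t - \<beta>) / \<bar>t - \<beta>\<bar> = sgn (t - \<beta>)"
    by (simp add: real_sgn_eq)
  finally show ?thesis
    by (simp add: root_ent_def)
qed

lemma root_ent_nonzero:
  assumes "0 < \<beta>" "\<beta> < 1" "0 < t" "t < 1" "t \<noteq> \<beta>"
  shows "root_ent \<beta> t \<noteq> 0"
proof
  assume "root_ent \<beta> t = 0"
  then show False
    using root_ent_mean_fisher[OF assms] mean_fisher_ge_4[OF assms] assms(5) by simp
qed

lemma root_ent_deriv:
  assumes "0 < \<beta>" "\<beta> < 1" "0 < t" "t < 1" "t \<noteq> \<beta>"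
  shows "(root_ent \<beta> has_real_derivative (t - \<beta>) * fisher t / (2 * root_ent \<beta> t)) (at t)"
proof -
  have pos: "0 < rel_ent \<beta> t"
    using rel_ent_ge[OF assms(1-4)] assms(5) by (smt (verit) zero_less_power2)
  have "((\<lambda>s. sgn (t - \<beta>) * sqrt (rel_ent \<beta> s)) has_real_derivative
      sgn (t - \<beta>) * ((t - \<beta>) * fisher t * (inverse (sqrt (rel_ent \<beta> t)) / 2))) (at t)"
    using pos assms by (auto intro!: derivative_eq_intros rel_ent_deriv)
  moreover have "sgn (t - \<beta>) * ((t - \<beta>) * fisher t * (inverse (sqrt (rel_ent \<beta> t)) / 2))
      = (t - \<beta>) * fisher t / (2 * root_ent \<beta> t)"
  proof -
    have flip: "e * (y * (inverse s / 2)) = y / (2 * (e * s))" if "e = 1 \<or> e = - 1" for e y s :: real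
      using that by (elim disjE) (simp_all add: inverse_eq_divide mult.commute)
    have "sgn (t - \<beta>) = 1 \<or> sgn (t - \<beta>) = - 1"
      using assms(5) by (auto simp: sgn_real_def)
    from flip[OF this] show ?thesis
      unfolding root_ent_def .
  qed
  ultimately have "((\<lambda>s. sgn (t - \<beta>) * sqrt (rel_ent \<beta> s)) has_real_derivative
      (t - \<beta>) * fisher t / (2 * root_ent \<beta> t)) (at t)"
    by (simp only:)
  then show ?thesis
  proof (rule has_field_derivative_transform_within_open)
    show "open (if t < \<beta> then {..<\<beta>} else {\<beta><..})" by simp
    show "t \<in> (if t < \<beta> then {..<\<beta>} else {\<beta><..})" using assms(5) by simp
    show "sgn (t - \<beta>) * sqrt (rel_ent \<beta> s) = root_ent \<beta> s"
      if "s \<in> (if t < \<beta> then {..<\<beta>} else {\<beta><..})" for s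
      using that assms(5) by (auto simp: root_ent_def sgn_real_def split: if_splits)
  qed
qed

text \<open>The derivative of \<open>amplitude \<beta>\<close>, with the double pole at \<open>\<beta>\<close> displayed as a denominator: the estimate
  needed is that the numerator has a double zero there.\<close>
definition amplitude_slope :: "real \<Rightarrow> real \<Rightarrow> real" where
  "amplitude_slope \<beta> t =
     (fisher t / (mean_fisher \<beta> t * sqrt (mean_fisher \<beta> t)) - sqrt (\<beta> * (1 - \<beta>))) / (t - \<beta>)\<^sup>2"

lemma amplitude_deriv:
  assumes "0 < \<beta>" "\<beta> < 1" "0 < t" "t < 1" "t \<noteq> \<beta>"
  shows "(amplitude \<beta> has_real_derivative amplitude_slope \<beta> t) (at t)"
proof -
  define \<sigma> where "\<sigma> = sqrt (\<beta> * (1 - \<beta>))"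
  define \<kappa> where "\<kappa> = (1 - \<beta>) / \<sigma>"
  define w where "w = t - \<beta>"
  define q where "q = sqrt (mean_fisher \<beta> t)"
  define R where "R = root_ent \<beta> t"
  have \<sigma>: "0 < \<sigma>" "\<sigma>\<^sup>2 = \<beta> * (1 - \<beta>)"
    using assms by (simp_all add: \<sigma>_def)
  have w: "w \<noteq> 0" using assms by (simp add: w_def)
  have q: "0 < q" "q\<^sup>2 = mean_fisher \<beta> t"
    using mean_fisher_ge_4[OF assms] by (simp_all add: q_def)
  have R: "R \<noteq> 0" "sqrt 2 * R = w * q"
    using root_ent_nonzero[OF assms] root_ent_mean_fisher[OF assms] by (simp_all add: R_def w_def q_def)
  have "((\<lambda>s. \<kappa> * (s / (s - \<beta>)) - 1 / (sqrt 2 * root_ent \<beta> s)) has_real_derivative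
      \<kappa> * ((w - t) / (w * w)) + sqrt 2 * (w * fisher t / (2 * R)) / ((sqrt 2 * R) * (sqrt 2 * R))) (at t)"
    using R(1) w assms(5)
    by (auto intro!: derivative_eq_intros root_ent_deriv[OF assms] simp: R_def w_def)
       (simp add: diff_divide_distrib right_diff_distrib)
  also have "(\<lambda>s. \<kappa> * (s / (s - \<beta>)) - 1 / (sqrt 2 * root_ent \<beta> s)) = amplitude \<beta>"
    by (simp add: amplitude_def \<kappa>_def \<sigma>_def fun_eq_iff)
  also have "sqrt 2 * (w * fisher t / (2 * R)) = w * fisher t / (sqrt 2 * R)"
    using R(1) by (simp add: field_simps)
  also have "w * fisher t / (sqrt 2 * R) / ((sqrt 2 * R) * (sqrt 2 * R)) = fisher t / (q\<^sup>2 * q) / w\<^sup>2"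
    unfolding R(2) using w q(1) by (simp add: field_simps power2_eq_square)
  also have "\<kappa> * ((w - t) / (w * w)) = - (\<sigma> / w\<^sup>2)"
  proof -
    have "\<kappa> * \<beta> = \<sigma>"
      using \<sigma> by (simp add: \<kappa>_def field_simps power2_eq_square)
    moreover have "w - t = - \<beta>"
      by (simp add: w_def)
    ultimately show ?thesis
      by (simp add: power2_eq_square)
  qed
  finally show ?thesis
    unfolding q(2) by (simp add: amplitude_slope_def \<sigma>_def q_def w_def diff_divide_distrib)
qed

lemma sqrt_variance_le: "sqrt (\<beta> * (1 - \<beta>)) \<le> 1 / 2"
proof -
  have "\<beta> * (1 - \<beta>) = (1 / 2)\<^sup>2 - (\<beta> - 1 / 2)\<^sup>2"
    by (simp add: power2_eq_square algebra_simps)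
  then have "\<beta> * (1 - \<beta>) \<le> (1 / 2)\<^sup>2" by simp
  then show ?thesis
    by (intro real_le_lsqrt) auto
qed

text \<open>Read \<open>f\<close> as \<open>fisher t\<close>, \<open>e\<close> as its weighted mean and \<open>c\<close> as \<open>fisher \<beta>\<close>. The linear
  terms of \<open>f\<^sup>2 * c\<close> and of \<open>e ^ 3\<close> are \<open>2 * c\<^sup>2 * u\<close> and \<open>3 * c\<^sup>2 * (2 / 3 * u)\<close>, hence equal.\<close>
lemma cubic_mismatch_bound:
  fixes c f e u k w :: real
  assumes k: "0 \<le> k" "\<bar>w\<bar> \<le> 1" "0 \<le> c" "c \<le> k" "0 \<le> f" "f \<le> k" "0 \<le> e" "e \<le> k"
    and u: "\<bar>u\<bar> \<le> k * \<bar>w\<bar>"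
    and f: "\<bar>f - (c + u)\<bar> \<le> k * w\<^sup>2"
    and e: "\<bar>e - (c + 2 / 3 * u)\<bar> \<le> k * w\<^sup>2"
  shows "\<bar>f\<^sup>2 * c - e ^ 3\<bar> \<le> 11 * k ^ 3 * w\<^sup>2"
proof -
  define a d where "a = c + u" and "d = c + 2 / 3 * u"
  have uk: "\<bar>u\<bar> \<le> k"
    using u mult_left_mono[OF k(2,1)] by simp
  have a: "\<bar>a\<bar> \<le> 2 * k" and d: "\<bar>d\<bar> \<le> 2 * k"
    using uk k by (auto simp: a_def d_def)
  have "\<bar>c * (f - a) * (f + a)\<bar> \<le> k * (k * w\<^sup>2) * (3 * k)"
    unfolding abs_mult using k a f by (intro mult_mono) (auto simp: a_def)
  moreover have "\<bar>u\<^sup>2 * (c / 3 + 8 / 27 * u)\<bar> \<le> (k * \<bar>w\<bar>)\<^sup>2 * k"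
    unfolding abs_mult using k uk u
    by (intro mult_mono) (auto simp: abs_le_square_iff[symmetric])
  moreover have "\<bar>(d - e) * (d * d + d * e + e * e)\<bar> \<le> (k * w\<^sup>2) * (2 * k * (2 * k) + 2 * k * k + k * k)"
  proof -
    have "\<bar>d * d\<bar> \<le> 2 * k * (2 * k)" "\<bar>d * e\<bar> \<le> 2 * k * k" "\<bar>e * e\<bar> \<le> k * k"
      unfolding abs_mult using d k by (intro mult_mono; simp)+
    then have "\<bar>d * d + d * e + e * e\<bar> \<le> 2 * k * (2 * k) + 2 * k * k + k * k"
      by linarith
    moreover have "\<bar>d - e\<bar> \<le> k * w\<^sup>2"
      using e by (simp add: d_def abs_minus_commute)
    ultimately show ?thesis
      unfolding abs_mult by (intro mult_mono) auto
  qed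
  moreover have "f\<^sup>2 * c - e ^ 3 =
      c * (f - a) * (f + a) - u\<^sup>2 * (c / 3 + 8 / 27 * u) + (d - e) * (d * d + d * e + e * e)"
    by (simp add: a_def d_def power2_eq_square power3_eq_cube field_simps)
  ultimately have "\<bar>f\<^sup>2 * c - e ^ 3\<bar> \<le> k * (k * w\<^sup>2) * (3 * k) + (k * \<bar>w\<bar>)\<^sup>2 * k
      + (k * w\<^sup>2) * (2 * k * (2 * k) + 2 * k * k + k * k)"
    by linarith
  also have "\<dots> = 11 * k ^ 3 * w\<^sup>2"
    by (simp add: power_mult_distrib power2_eq_square power3_eq_cube algebra_simps)
  finally show ?thesis .
qed

text \<open>Far from \<open>\<beta>\<close> the denominator of \<open>amplitude_slope\<close> is bounded below. Near \<open>\<beta>\<close>, rationalising the square root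
  turns the numerator into a bounded multiple of the difference in \<open>cubic_mismatch_bound\<close>, which is
  quadratic in \<open>t - \<beta>\<close>.\<close>
lemma amplitude_slope_bound:
  assumes "0 < \<eta>"
  obtains K where "0 < K"
    "\<And>\<beta> t. \<eta> \<le> \<beta> \<Longrightarrow> \<beta> \<le> 1 - \<eta> \<Longrightarrow> 0 < t \<Longrightarrow> t < 1 \<Longrightarrow> t \<noteq> \<beta> \<Longrightarrow>
       \<bar>amplitude_slope \<beta> t\<bar> \<le> K * fisher t"
proof -
  define k where "k = 4 / \<eta> ^ 3"
  \<comment> \<open>the first term serves \<open>\<bar>t - \<beta>\<bar> > \<eta> / 2\<close>, the second \<open>\<bar>t - \<beta>\<bar> \<le> \<eta> / 2\<close>\<close>
  define K where "K = 4 / \<eta>\<^sup>2 + 11 * k ^ 3"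
  have k: "0 < k" using assms by (simp add: k_def)
  have K: "0 < K" using assms k by (simp add: K_def add_pos_pos)
  moreover have "\<bar>amplitude_slope \<beta> t\<bar> \<le> K * fisher t"
    if \<beta>: "\<eta> \<le> \<beta>" "\<beta> \<le> 1 - \<eta>" and t: "0 < t" "t < 1" "t \<noteq> \<beta>" for \<beta> t
  proof -
    have \<beta>01: "0 < \<beta>" "\<beta> < 1" using assms \<beta> by auto
    define \<sigma> where "\<sigma> = sqrt (\<beta> * (1 - \<beta>))"
    define q where "q = sqrt (mean_fisher \<beta> t)"
    define w where "w = t - \<beta>"
    define f where "f = fisher t"
    have \<sigma>: "0 < \<sigma>" "\<sigma> \<le> 1 / 2"
      using \<beta>01 sqrt_variance_le by (auto simp: \<sigma>_def)
    have c4: "4 \<le> mean_fisher \<beta> t" using mean_fisher_ge_4[OF \<beta>01 t] .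
    have "sqrt 4 \<le> q" unfolding q_def using c4 by (rule real_sqrt_le_mono)
    then have q: "2 \<le> q" by simp
    have q2: "q\<^sup>2 = mean_fisher \<beta> t" using c4 by (simp add: q_def)
    have f: "4 \<le> f" using fisher_ge_4[OF t(1,2)] by (simp add: f_def)
    have w: "w \<noteq> 0" using t(3) by (simp add: w_def)
    have slope: "amplitude_slope \<beta> t = (f / (q\<^sup>2 * q) - \<sigma>) / w\<^sup>2"
      unfolding amplitude_slope_def q2 by (simp add: f_def q_def \<sigma>_def w_def)
    show ?thesis
    proof (cases "\<bar>w\<bar> \<le> \<eta> / 2")
      case False
      have "1 \<le> q\<^sup>2 * q" 
        using mult_mono[of 1 "q\<^sup>2" 1 q] q q2 c4 by simp
      then have "f / (q\<^sup>2 * q) \<le> f"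
        using f divide_left_mono[of 1 "q\<^sup>2 * q" f] by simp
      moreover have "0 \<le> f / (q\<^sup>2 * q)"
        using f q by simp
      ultimately have num: "\<bar>f / (q\<^sup>2 * q) - \<sigma>\<bar> \<le> f"
        using \<sigma> f by (simp add: abs_le_iff)
      have "(\<eta> / 2)\<^sup>2 \<le> \<bar>w\<bar>\<^sup>2"
        using False assms by (intro power_mono) auto
      then have "\<bar>amplitude_slope \<beta> t\<bar> \<le> f / (\<eta> / 2)\<^sup>2"
        unfolding slope abs_divide using num assms f
        by (intro frac_le) auto
      also have "\<dots> = 4 / \<eta>\<^sup>2 * f"
        by (simp add: power_divide)
      also have "\<dots> \<le> K * f"
        using k f by (intro mult_right_mono) (auto simp: K_def)
      finally show ?thesis by (simp add: f_def)
    next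
      case True
      define c where "c = fisher \<beta>"
      obtain u where u: "\<bar>u\<bar> \<le> k * \<bar>w\<bar>" "\<bar>f - (c + u)\<bar> \<le> k * w\<^sup>2"
          "\<bar>mean_fisher \<beta> t - (c + 2 / 3 * u)\<bar> \<le> k * w\<^sup>2" "c \<le> k" "f \<le> k" "mean_fisher \<beta> t \<le> k"
        using near_expansion[OF assms \<beta>, of t] w True unfolding k_def w_def f_def c_def by blast
      have c: "4 \<le> c" using fisher_ge_4[OF \<beta>01] by (simp add: c_def)
      have c\<sigma>: "c * \<sigma>\<^sup>2 = 1"
        using \<beta>01 by (simp add: c_def \<sigma>_def fisher_def)
      have cs: "c * \<sigma> = 1 / \<sigma>"
        using c\<sigma> \<sigma> by (simp add: field_simps power2_eq_square)
      have w1: "\<bar>w\<bar> \<le> 1"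
        using True \<beta> by simp
      have num: "\<bar>f\<^sup>2 * c - (mean_fisher \<beta> t) ^ 3\<bar> \<le> 11 * k ^ 3 * w\<^sup>2"
        by (rule cubic_mismatch_bound) (use k w1 c f c4 u in auto)
      have fac: "f / (q\<^sup>2 * q) - \<sigma> = (f\<^sup>2 * c - (mean_fisher \<beta> t) ^ 3) * (\<sigma>\<^sup>2 / (q ^ 3 * (f + \<sigma> * q ^ 3)))"
      proof -
        \<comment> \<open>rationalising: since \<open>c * \<sigma>\<^sup>2 = 1\<close>, the product \<open>(f\<^sup>2 * c - q ^ 6) * \<sigma>\<^sup>2\<close> is a difference of squares\<close>
        have pos: "0 < f + \<sigma> * q ^ 3" using f \<sigma> q by (intro add_pos_pos) auto
        have "(f\<^sup>2 * c - (mean_fisher \<beta> t) ^ 3) * \<sigma>\<^sup>2 = f\<^sup>2 * (c * \<sigma>\<^sup>2) - (\<sigma> * q ^ 3)\<^sup>2"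
          unfolding q2[symmetric] by (simp add: power_mult_distrib power_mult[symmetric] algebra_simps)
        also have "\<dots> = (f - \<sigma> * q ^ 3) * (f + \<sigma> * q ^ 3)"
          unfolding c\<sigma> by (simp add: power2_eq_square algebra_simps)
        finally have *: "(f\<^sup>2 * c - (mean_fisher \<beta> t) ^ 3) * \<sigma>\<^sup>2 = (f - \<sigma> * q ^ 3) * (f + \<sigma> * q ^ 3)" .
        have "(f\<^sup>2 * c - (mean_fisher \<beta> t) ^ 3) * (\<sigma>\<^sup>2 / (q ^ 3 * (f + \<sigma> * q ^ 3)))
            = ((f\<^sup>2 * c - (mean_fisher \<beta> t) ^ 3) * \<sigma>\<^sup>2) / (q ^ 3 * (f + \<sigma> * q ^ 3))"
          by simp
        also have "\<dots> = (f - \<sigma> * q ^ 3) / q ^ 3"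
          unfolding * using pos by simp
        also have "\<dots> = f / (q\<^sup>2 * q) - \<sigma>"
          using q by (simp add: diff_divide_distrib power2_eq_square power3_eq_cube)
        finally show ?thesis by simp
      qed
      have "0 \<le> \<sigma>\<^sup>2 / (q ^ 3 * (f + \<sigma> * q ^ 3))"
        using f \<sigma> q by (intro divide_nonneg_nonneg mult_nonneg_nonneg add_nonneg_nonneg) auto
      moreover have "\<sigma>\<^sup>2 / (q ^ 3 * (f + \<sigma> * q ^ 3)) \<le> 1"
      proof -
        have "\<sigma>\<^sup>2 \<le> 1" using \<sigma> by (simp add: power_le_one)
        also have "1 \<le> q ^ 3 * (f + \<sigma> * q ^ 3)"
        proof -
          have "1 \<le> q ^ 3" using q by (simp add: one_le_power)
          moreover have "0 \<le> \<sigma> * q ^ 3" using \<sigma> q by simp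
          ultimately show ?thesis
            using mult_mono[of 1 "q ^ 3" 1 "f + \<sigma> * q ^ 3"] f q by simp
        qed
        finally show ?thesis 
          using \<open>1 \<le> q ^ 3 * (f + \<sigma> * q ^ 3)\<close> by simp
      qed
      ultimately have "\<bar>\<sigma>\<^sup>2 / (q ^ 3 * (f + \<sigma> * q ^ 3))\<bar> \<le> 1"
        by linarith
      then have "\<bar>f / (q\<^sup>2 * q) - \<sigma>\<bar> \<le> 11 * k ^ 3 * w\<^sup>2 * 1"
        unfolding fac abs_mult by (intro mult_mono num) (use k in auto)
      then have "\<bar>amplitude_slope \<beta> t\<bar> \<le> 11 * k ^ 3"
        unfolding slope abs_divide using w by (simp add: divide_le_eq)
      also have "\<dots> \<le> K * 1" using assms by (simp add: K_def)
      also have "\<dots> \<le> K * f" using f K by (intro mult_left_mono) auto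
      finally show ?thesis by (simp add: f_def)
    qed
  qed
  ultimately show ?thesis using that by blast
qed

text \<open>The same cancellation one order lower: the simple poles of the two terms of \<open>A\<close> at \<open>\<beta>\<close> have equal
  residues.\<close>
lemma amplitude_bound:
  assumes "0 < \<eta>"
  obtains J where "0 < J"
    "\<And>\<beta> t. \<eta> \<le> \<beta> \<Longrightarrow> \<beta> \<le> 1 - \<eta> \<Longrightarrow> 0 < t \<Longrightarrow> t < 1 \<Longrightarrow> t \<noteq> \<beta> \<Longrightarrow> \<bar>amplitude \<beta> t\<bar> \<le> J"
proof -
  define k where "k = 4 / \<eta> ^ 3"
  define J where "J = 3 / \<eta> + 2 * k"
  have k: "0 < k" using assms by (simp add: k_def)
  have J: "0 < J" using assms k by (simp add: J_def add_pos_pos)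
  moreover have "\<bar>amplitude \<beta> t\<bar> \<le> J"
    if \<beta>: "\<eta> \<le> \<beta>" "\<beta> \<le> 1 - \<eta>" and t: "0 < t" "t < 1" "t \<noteq> \<beta>" for \<beta> t
  proof -
    have \<beta>01: "0 < \<beta>" "\<beta> < 1" using assms \<beta> by auto
    define \<sigma> where "\<sigma> = sqrt (\<beta> * (1 - \<beta>))"
    define q where "q = sqrt (mean_fisher \<beta> t)"
    define w where "w = t - \<beta>"
    have \<sigma>: "0 < \<sigma>" "\<sigma> \<le> 1 / 2" "\<sigma>\<^sup>2 = \<beta> * (1 - \<beta>)"
      using \<beta>01 sqrt_variance_le by (auto simp: \<sigma>_def)
    have c4: "4 \<le> mean_fisher \<beta> t" using mean_fisher_ge_4[OF \<beta>01 t] .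
    have "sqrt 4 \<le> q" unfolding q_def using c4 by (rule real_sqrt_le_mono)
    then have q: "2 \<le> q" by simp
    have q2: "q\<^sup>2 = mean_fisher \<beta> t" using c4 by (simp add: q_def)
    have w: "w \<noteq> 0" using t(3) by (simp add: w_def)
    have "\<eta> * \<eta> \<le> \<beta> * (1 - \<beta>)"
      using assms \<beta> by (intro mult_mono) auto
    then have "sqrt (\<eta> * \<eta>) \<le> \<sigma>"
      unfolding \<sigma>_def by (rule real_sqrt_le_mono)
    then have \<eta>\<sigma>: "\<eta> \<le> \<sigma>" using assms by simp
    have \<kappa>: "0 \<le> (1 - \<beta>) / \<sigma>" "(1 - \<beta>) / \<sigma> \<le> 1 / \<eta>"
      using \<sigma>(1) \<beta>01 \<eta>\<sigma> assms by (auto intro!: frac_le)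
    have \<kappa>\<beta>: "(1 - \<beta>) / \<sigma> * \<beta> = \<sigma>"
      using \<sigma> by (simp add: field_simps power2_eq_square)
    have "(1 - \<beta>) / \<sigma> * t = (1 - \<beta>) / \<sigma> * w + \<sigma>"
      using \<kappa>\<beta> unfolding w_def by (simp only: right_diff_distrib)
    then have "amplitude \<beta> t = ((1 - \<beta>) / \<sigma> * w + \<sigma>) / w - 1 / (w * q)"
      by (simp add: amplitude_def root_ent_mean_fisher[OF \<beta>01 t] \<sigma>_def w_def q_def)
    also have "\<dots> = (1 - \<beta>) / \<sigma> + (\<sigma> - 1 / q) / w"
      using w q by (simp add: field_simps)
    finally have amplitude: "amplitude \<beta> t = (1 - \<beta>) / \<sigma> + (\<sigma> - 1 / q) / w" .
    have "\<bar>(\<sigma> - 1 / q) / w\<bar> \<le> 2 / \<eta> + 2 * k"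
    proof (cases "\<bar>w\<bar> \<le> \<eta> / 2")
      case False
      have "0 \<le> 1 / q" "1 / q \<le> 1" using q by auto
      then have "\<bar>\<sigma> - 1 / q\<bar> \<le> 1" using \<sigma> by linarith
      then have "\<bar>(\<sigma> - 1 / q) / w\<bar> \<le> 1 / (\<eta> / 2)"
        unfolding abs_divide using False assms by (intro frac_le) auto
      then show ?thesis using k by simp
    next
      case True
      define c where "c = fisher \<beta>"
      obtain u where u: "\<bar>u\<bar> \<le> k * \<bar>w\<bar>" 
          "\<bar>mean_fisher \<beta> t - (c + 2 / 3 * u)\<bar> \<le> k * w\<^sup>2"
        using near_expansion[OF assms \<beta>, of t] w True unfolding k_def w_def c_def by blast
      have c\<sigma>: "c * \<sigma>\<^sup>2 = 1"
        using \<beta>01 by (simp add: c_def \<sigma>_def fisher_def)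
      have "\<bar>w\<bar> \<le> 1" using True \<beta> by simp
      then have "\<bar>w\<bar>\<^sup>2 \<le> \<bar>w\<bar>"
        by (simp add: power2_eq_square mult_left_le_one_le del: abs_mult_self_eq)
      then have "k * w\<^sup>2 \<le> k * \<bar>w\<bar>"
        using k by (intro mult_left_mono) auto
      then have diff: "\<bar>mean_fisher \<beta> t - c\<bar> \<le> 2 * (k * \<bar>w\<bar>)"
        using u by linarith
      have pos: "0 < q * (1 + \<sigma> * q)" using q \<sigma> by (intro mult_pos_pos add_pos_pos) auto
      have "(mean_fisher \<beta> t - c) * \<sigma>\<^sup>2 = (\<sigma> * q)\<^sup>2 - c * \<sigma>\<^sup>2"
        unfolding q2[symmetric] by (simp add: power_mult_distrib algebra_simps)
      also have "\<dots> = (\<sigma> * q - 1) * (1 + \<sigma> * q)"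
        unfolding c\<sigma> by (simp add: power2_eq_square algebra_simps)
      finally have *: "(mean_fisher \<beta> t - c) * \<sigma>\<^sup>2 = (\<sigma> * q - 1) * (1 + \<sigma> * q)" .
      have "(mean_fisher \<beta> t - c) * (\<sigma>\<^sup>2 / (q * (1 + \<sigma> * q))) = (\<sigma> * q - 1) * (1 + \<sigma> * q) / (q * (1 + \<sigma> * q))"
        unfolding *[symmetric] by simp
      also have "\<dots> = \<sigma> - 1 / q"
      proof -
        have "1 + \<sigma> * q \<noteq> 0" using pos by auto
        then show ?thesis using q by (simp add: diff_divide_distrib)
      qed
      finally have fac: "\<sigma> - 1 / q = (mean_fisher \<beta> t - c) * (\<sigma>\<^sup>2 / (q * (1 + \<sigma> * q)))" by simp
      have "\<sigma>\<^sup>2 / (q * (1 + \<sigma> * q)) \<le> 1"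
      proof -
        have "\<sigma>\<^sup>2 \<le> 1" using \<sigma>(1,2) by (simp add: power_le_one)
        also have "1 \<le> q * (1 + \<sigma> * q)"
          using mult_mono[of 1 q 1 "1 + \<sigma> * q"] q \<sigma> by simp
        finally show ?thesis using pos by simp
      qed
      moreover have "0 \<le> \<sigma>\<^sup>2 / (q * (1 + \<sigma> * q))"
        using pos by (intro divide_nonneg_nonneg) auto
      ultimately have "\<bar>\<sigma>\<^sup>2 / (q * (1 + \<sigma> * q))\<bar> \<le> 1"
        by linarith
      then have "\<bar>\<sigma> - 1 / q\<bar> \<le> 2 * (k * \<bar>w\<bar>) * 1"
        unfolding fac abs_mult by (intro mult_mono diff) (use k in auto)
      then have "\<bar>(\<sigma> - 1 / q) / w\<bar> \<le> 2 * k"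
        unfolding abs_divide using w by (simp add: divide_le_eq)
      then show ?thesis using assms by (auto intro: order_trans)
    qed
    note bd = this
    have "\<bar>amplitude \<beta> t\<bar> \<le> \<bar>(1 - \<beta>) / \<sigma>\<bar> + \<bar>(\<sigma> - 1 / q) / w\<bar>"
      unfolding amplitude by (rule abs_triangle_ineq)
    also have "\<dots> \<le> 1 / \<eta> + (2 / \<eta> + 2 * k)"
      using \<kappa> by (intro add_mono bd) (simp only: abs_of_nonneg)
    also have "\<dots> = J"
      by (simp add: J_def add_divide_distrib[symmetric])
    finally show ?thesis .
  qed
  ultimately show ?thesis using that by blast
qed

section \<open>Comparing the distribution function with its approximation\<close>

text \<open>The mean value theorem as a comparison: \<open>V\<close> acts as a budget for the variation of \<open>F\<close>.\<close>
lemma abs_diff_le_of_deriv_le: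
  fixes F V :: "real \<Rightarrow> real"
  assumes "s \<le> t"
    and deriv: "\<And>x. s \<le> x \<Longrightarrow> x \<le> t \<Longrightarrow>
      \<exists>F' V'. (F has_real_derivative F') (at x) \<and> (V has_real_derivative V') (at x) \<and> \<bar>F'\<bar> \<le> V'"
  shows "\<bar>F t - F s\<bar> \<le> V t - V s"
proof -
  have "V s - F s \<le> V t - F t"
  proof (rule DERIV_nonneg_imp_nondecreasing[OF assms(1)])
    fix x assume "s \<le> x" "x \<le> t"
    with deriv obtain F' V' where *: "(F has_real_derivative F') (at x)" "(V has_real_derivative V') (at x)"
      "\<bar>F'\<bar> \<le> V'" by blast
    show "\<exists>y. ((\<lambda>x. V x - F x) has_real_derivative y) (at x) \<and> 0 \<le> y"
      by (rule exI[of _ "V' - F'"]) (use * in \<open>auto intro: DERIV_diff\<close>)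
  qed
  moreover have "V s + F s \<le> V t + F t"
  proof (rule DERIV_nonneg_imp_nondecreasing[OF assms(1)])
    fix x assume "s \<le> x" "x \<le> t"
    with deriv obtain F' V' where *: "(F has_real_derivative F') (at x)" "(V has_real_derivative V') (at x)"
      "\<bar>F'\<bar> \<le> V'" by blast
    show "\<exists>y. ((\<lambda>x. V x + F x) has_real_derivative y) (at x) \<and> 0 \<le> y"
      by (rule exI[of _ "V' + F'"]) (use * in \<open>auto intro: DERIV_add\<close>)
  qed
  ultimately show ?thesis
    by linarith
qed

lemma rel_ent_at_left_1:
  assumes "\<beta> < 1"
  shows "filterlim (rel_ent \<beta>) at_top (at_left 1)"
proof -
  have "filterlim (\<lambda>t::real. 1 - t) (at_right 0) (at_left 1)"
    unfolding filterlim_at by (auto intro!: tendsto_eq_intros simp: eventually_at_filter)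
  then have "filterlim (\<lambda>t::real. - ln (1 - t)) at_top (at_left 1)"
    using filterlim_compose[OF ln_at_0] by (simp add: filterlim_uminus_at_top)
  then have "filterlim (\<lambda>t::real. (1 - \<beta>) * - ln (1 - t)) at_top (at_left 1)"
    using assms by (intro filterlim_tendsto_pos_mult_at_top[OF tendsto_const]) auto
  moreover have "((\<lambda>t. - \<beta> * ln t - h \<beta>) \<longlongrightarrow> - \<beta> * ln 1 - h \<beta>) (at_left 1)"
    by (intro tendsto_intros) auto
  ultimately have "filterlim (\<lambda>t. (- \<beta> * ln t - h \<beta>) + (1 - \<beta>) * - ln (1 - t)) at_top (at_left 1)"
    by (intro filterlim_tendsto_add_at_top)
  then show ?thesis
    by (simp add: rel_ent_def[abs_def] algebra_simps)
qed

lemma rel_ent_at_right_0: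
  assumes "0 < \<beta>"
  shows "filterlim (rel_ent \<beta>) at_top (at_right 0)"
proof -
  have "filterlim (\<lambda>t::real. - ln t) at_top (at_right 0)"
    using ln_at_0 by (simp add: filterlim_uminus_at_top)
  then have "filterlim (\<lambda>t::real. \<beta> * - ln t) at_top (at_right 0)"
    using assms by (intro filterlim_tendsto_pos_mult_at_top[OF tendsto_const]) auto
  moreover have "((\<lambda>t. - (1 - \<beta>) * ln (1 - t) - h \<beta>) \<longlongrightarrow> - (1 - \<beta>) * ln (1 - 0) - h \<beta>) (at_right 0)"
    by (intro tendsto_intros) auto
  ultimately have "filterlim (\<lambda>t. (- (1 - \<beta>) * ln (1 - t) - h \<beta>) + \<beta> * - ln t) at_top (at_right 0)"
    by (intro filterlim_tendsto_add_at_top)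
  then show ?thesis
    by (simp add: rel_ent_def[abs_def] algebra_simps)
qed

lemma root_ent_tendsto_0:
  assumes "0 < \<beta>" "\<beta> < 1"
  shows "(root_ent \<beta> \<longlongrightarrow> 0) (at \<beta>)"
proof (rule Lim_null_comparison)
  have "isCont (rel_ent \<beta>) \<beta>"
    using rel_ent_deriv[OF assms, of \<beta>] by (rule DERIV_isCont)
  then have "(rel_ent \<beta> \<longlongrightarrow> 0) (at \<beta>)"
    by (simp add: isCont_def rel_ent_self)
  then have "((\<lambda>t. \<bar>sqrt (rel_ent \<beta> t)\<bar>) \<longlongrightarrow> \<bar>sqrt 0\<bar>) (at \<beta>)"
    by (intro tendsto_intros)
  then show "((\<lambda>t. \<bar>sqrt (rel_ent \<beta> t)\<bar>) \<longlongrightarrow> 0) (at \<beta>)"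
    by simp
  show "\<forall>\<^sub>F t in at \<beta>. norm (root_ent \<beta> t) \<le> \<bar>sqrt (rel_ent \<beta> t)\<bar>"
    by (rule always_eventually) (simp add: root_ent_def abs_mult sgn_real_def)
qed

text \<open>From here on \<open>m\<close> and \<open>r\<close> are fixed and \<open>t\<close> varies. The constants \<open>K\<close> and \<open>J\<close> of the uniform bounds
  are parameters, so that no estimate can depend on \<open>m\<close>, \<open>r\<close> or \<open>t\<close> through them.\<close>
locale binomial_tail =
  fixes m r :: nat and \<beta> K J :: real
  assumes r_bounds: "0 < r" "r < m"
    and \<beta>_eq: "\<beta> = real r / real m"
    and slope_bound: "\<And>t. 0 < t \<Longrightarrow> t < 1 \<Longrightarrow> t \<noteq> \<beta> \<Longrightarrow> \<bar>amplitude_slope \<beta> t\<bar> \<le> K * fisher t"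
    and amplitude_bound: "\<And>t. 0 < t \<Longrightarrow> t < 1 \<Longrightarrow> t \<noteq> \<beta> \<Longrightarrow> \<bar>amplitude \<beta> t\<bar> \<le> J"
begin

definition "\<sigma> = sqrt (\<beta> * (1 - \<beta>))"
definition "c = sqrt (2 * real m * pi)"
definition "damping t = exp (- real m * rel_ent \<beta> t)"
text \<open>The quotient of \<open>m choose r\<close> by the approximation \<open>exp (m * h \<beta>) / sqrt (2 * pi * m * \<beta> * (1 - \<beta>))\<close> of
  Stirling's formula. That it is close to \<open>1\<close> comes out in the proof of \<open>relative_error\<close>.\<close>
definition "stirling_ratio = real (m choose r) * exp (- real m * h \<beta>) * (c * \<sigma>)"
definition "scaled_cdf t = binomial_cdf m r t / stirling_ratio"
definition "approx t = 1 / 2 * erfc (sqrt (real m) * root_ent \<beta> t) + amplitude \<beta> t / c * damping t"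
definition "err t = approx t - scaled_cdf t"

lemma m_pos: "0 < real m"
  using r_bounds by simp

lemma \<beta>_unit: "0 < \<beta>" "\<beta> < 1"
  using r_bounds by (auto simp: \<beta>_eq)

lemma \<sigma>_pos: "0 < \<sigma>" and \<sigma>_power2: "\<sigma>\<^sup>2 = \<beta> * (1 - \<beta>)"
  using \<beta>_unit by (auto simp: \<sigma>_def)

lemma c_pos: "0 < c"
  using m_pos by (simp add: c_def)

lemma stirling_ratio_pos: "0 < stirling_ratio"
  using r_bounds c_pos \<sigma>_pos by (simp add: stirling_ratio_def zero_less_binomial_iff)

lemma K_nonneg: "0 \<le> K"
proof -
  have t: "0 < \<beta> / 2" "\<beta> / 2 < 1" "\<beta> / 2 \<noteq> \<beta>" using \<beta>_unit by auto
  have "0 \<le> K * fisher (\<beta> / 2)"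
    using slope_bound[OF t] by linarith
  then show ?thesis
    using fisher_ge_4[OF t(1,2)] by (simp add: zero_le_mult_iff)
qed

lemma J_nonneg: "0 \<le> J"
proof -
  have t: "0 < \<beta> / 2" "\<beta> / 2 < 1" "\<beta> / 2 \<noteq> \<beta>" using \<beta>_unit by auto
  then show ?thesis using amplitude_bound[OF t] by linarith
qed

lemma damping_pos: "0 < damping t"
  by (simp add: damping_def)

lemma damping_le_1:
  assumes "0 < t" "t < 1"
  shows "damping t \<le> 1"
proof -
  have "0 \<le> rel_ent \<beta> t"
    using rel_ent_ge[OF \<beta>_unit assms] by (rule order_trans[rotated]) simp
  then show ?thesis by (simp add: damping_def)
qed

lemma damping_deriv:
  assumes "0 < t" "t < 1"
  shows "(damping has_real_derivative - (real m * (t - \<beta>) * fisher t * damping t)) (at t)"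
  unfolding damping_def[abs_def]
  by (rule derivative_eq_intros rel_ent_deriv assms refl)+ simp

lemma scaled_cdf_deriv:
  assumes "0 < t" "t < 1"
  shows "(scaled_cdf has_real_derivative - (real m * (1 - \<beta>) / (c * \<sigma>) * (damping t / (1 - t)))) (at t)"
proof -
  have mr: "real (m - r) = real m * (1 - \<beta>)"
    using r_bounds by (simp add: \<beta>_eq of_nat_diff field_simps)
  have "t ^ r * (1 - t) ^ (m - r) = exp (real r * ln t) * exp (real (m - r) * ln (1 - t))"
    using assms by (simp add: exp_of_nat_mult)
  also have "\<dots> = exp (- real m * h \<beta>) * damping t"
    using m_pos unfolding mr damping_def rel_ent_def exp_add[symmetric] 
    by (simp add: \<beta>_eq field_simps)
  finally have pow: "t ^ r * (1 - t) ^ (m - r) = exp (- real m * h \<beta>) * damping t" .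
  have "(1 - t) ^ (m - r) = (1 - t) ^ (m - Suc r) * (1 - t)"
    using r_bounds by (metis Suc_diff_Suc power_Suc2)
  then have "t ^ r * (1 - t) ^ (m - Suc r) = t ^ r * (1 - t) ^ (m - r) / (1 - t)"
    using assms by simp
  then have eq: "real (m - r) * real (m choose r) * t ^ r * (1 - t) ^ (m - Suc r) / stirling_ratio
      = real m * (1 - \<beta>) / (c * \<sigma>) * (damping t / (1 - t))"
    using stirling_ratio_pos unfolding mult.assoc pow stirling_ratio_def mr by (simp add: mult.assoc zero_less_mult_iff)
  show ?thesis
    unfolding scaled_cdf_def[abs_def] eq[symmetric]
    using DERIV_cdivide[OF binomial_cdf_deriv[OF r_bounds(2), of t], of stirling_ratio] by simp
qed

text \<open>This identity is the reason for the form of \<open>A\<close>: the part of the derivative that comes from \<open>erfc\<close> cancels the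
  term \<open>1 / (sqrt 2 * \<rho>)\<close> of \<open>A\<close> times the derivative of the exponential, and the other term of \<open>A\<close> then
  reproduces the derivative of the distribution function.\<close>
lemma err_deriv:
  assumes "0 < t" "t < 1" "t \<noteq> \<beta>"
  shows "(err has_real_derivative amplitude_slope \<beta> t / c * damping t) (at t)"
proof -
  define R where "R = root_ent \<beta> t"
  define w where "w = t - \<beta>"
  have R: "R \<noteq> 0" using root_ent_nonzero[OF \<beta>_unit assms] by (simp add: R_def)
  have damp: "exp (- (sqrt (real m) * R)\<^sup>2) = damping t"
    using root_ent_power2[OF \<beta>_unit assms(1,2)] m_pos
    by (simp add: power_mult_distrib damping_def R_def)
  have "((\<lambda>t. erfc (sqrt (real m) * root_ent \<beta> t)) has_real_derivative
      - (2 / sqrt pi * exp (- (sqrt (real m) * R)\<^sup>2)) * (sqrt (real m) * (w * fisher t / (2 * R)))) (at t)"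
    unfolding R_def w_def
    by (rule DERIV_chain2[OF erfc_deriv]) (rule DERIV_cmult[OF root_ent_deriv[OF \<beta>_unit assms]])
  then have "(err has_real_derivative
      1 / 2 * (- (2 / sqrt pi * damping t) * (sqrt (real m) * (w * fisher t / (2 * R))))
      + (amplitude_slope \<beta> t / c * damping t + - (real m * w * fisher t * damping t) * (amplitude \<beta> t / c))
      - - (real m * (1 - \<beta>) / (c * \<sigma>) * (damping t / (1 - t)))) (at t)"
    unfolding err_def[abs_def] approx_def damp w_def
    by (intro DERIV_diff DERIV_add DERIV_cmult DERIV_mult DERIV_cdivide
        scaled_cdf_deriv damping_deriv amplitude_deriv \<beta>_unit assms)
  moreover have "1 / 2 * (- (2 / sqrt pi * damping t) * (sqrt (real m) * (w * fisher t / (2 * R))))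
      + (amplitude_slope \<beta> t / c * damping t + - (real m * w * fisher t * damping t) * (amplitude \<beta> t / c))
      - - (real m * (1 - \<beta>) / (c * \<sigma>) * (damping t / (1 - t))) = amplitude_slope \<beta> t / c * damping t"
  proof -
    \<comment> \<open>the contribution of \<open>erfc\<close>, rewritten over the common factor \<open>real m / c * damping t\<close>\<close>
    have "sqrt (real m) / sqrt pi = sqrt 2 * real m / c"
      using m_pos by (simp add: c_def real_sqrt_mult field_simps)
    then have "1 / 2 * (- (2 / sqrt pi * damping t) * (sqrt (real m) * (w * fisher t / (2 * R))))
        = - (sqrt 2 * real m / c * (w * fisher t / (2 * R)) * damping t)"
      by (simp add: field_simps)
    also have "\<dots> = - (real m / c * damping t * (w * fisher t / (sqrt 2 * R)))"
      using R c_pos by (simp add: field_simps)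
    finally have e: "1 / 2 * (- (2 / sqrt pi * damping t) * (sqrt (real m) * (w * fisher t / (2 * R))))
        = - (real m / c * damping t * (w * fisher t / (sqrt 2 * R)))" .
    have "amplitude \<beta> t * (w * fisher t) = (1 - \<beta>) / \<sigma> * (t / w * (w * fisher t)) - w * fisher t / (sqrt 2 * R)"
    proof -
      have "amplitude \<beta> t = (1 - \<beta>) / \<sigma> * (t / w) - 1 / (sqrt 2 * R)"
        by (simp add: amplitude_def \<sigma>_def w_def R_def)
      moreover have "(x * y - 1 / z) * v = x * (y * v) - v / z" for x y z v :: real
        by (simp add: left_diff_distrib mult.assoc)
      ultimately show ?thesis by (simp only:)
    qed
    also have "t / w * (w * fisher t) = 1 / (1 - t)"
    proof -
      have "t / w * (w * fisher t) = t * fisher t" using assms by (simp add: w_def)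
      then show ?thesis using assms by (simp add: fisher_def)
    qed
    finally have a: "amplitude \<beta> t * (w * fisher t) = (1 - \<beta>) / \<sigma> * (1 / (1 - t)) - w * fisher t / (sqrt 2 * R)" .
    have "- (real m * w * fisher t * damping t) * (amplitude \<beta> t / c) 
        = - (real m / c * damping t * (amplitude \<beta> t * (w * fisher t)))"
      by simp
    also have "\<dots> = - (real m * (1 - \<beta>) / (c * \<sigma>) * (damping t / (1 - t)))
        + real m / c * damping t * (w * fisher t / (sqrt 2 * R))"
      unfolding a right_diff_distrib[of "real m / c * damping t"] by (simp add: mult_ac)
    finally show ?thesis
      unfolding e by simp
  qed
  ultimately show ?thesis by (simp only:)
qed

lemma scaled_cdf_pos: "0 \<le> t \<Longrightarrow> t < 1 \<Longrightarrow> 0 < scaled_cdf t"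
  using binomial_cdf_pos stirling_ratio_pos by (simp add: scaled_cdf_def)

lemma isCont_scaled_cdf: "isCont scaled_cdf t"
  unfolding scaled_cdf_def[abs_def]
  using DERIV_isCont[OF DERIV_cdivide[OF binomial_cdf_deriv[OF r_bounds(2)]]] .

lemma scaled_cdf_tendsto: "(scaled_cdf \<longlongrightarrow> scaled_cdf x) (at x within S)"
  by (rule tendsto_within_subset[OF isCont_scaled_cdf[of x, unfolded isCont_def] subset_UNIV])

lemma amplitude_term_bound:
  assumes "0 < t" "t < 1" "t \<noteq> \<beta>"
  shows "\<bar>amplitude \<beta> t / c * damping t\<bar> \<le> J / c * damping t"
proof -
  have "\<bar>amplitude \<beta> t / c * damping t\<bar> = \<bar>amplitude \<beta> t\<bar> / c * damping t"
    using c_pos damping_pos[of t] by (simp add: abs_mult)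
  also have "\<dots> \<le> J / c * damping t"
    using amplitude_bound[OF assms] c_pos damping_pos[of t]
    by (intro mult_right_mono divide_right_mono) auto
  finally show ?thesis .
qed

lemma approx_tendsto:
  assumes D: "filterlim (rel_ent \<beta>) at_top F"
    and t: "\<forall>\<^sub>F t in F. 0 < t \<and> t < 1 \<and> t \<noteq> \<beta>"
    and E: "((\<lambda>t. erfc (sqrt (real m) * root_ent \<beta> t)) \<longlongrightarrow> L) F"
  shows "(approx \<longlongrightarrow> L / 2) F"
proof -
  have "filterlim (\<lambda>t. real m * rel_ent \<beta> t) at_top F"
    using m_pos D by (intro filterlim_tendsto_pos_mult_at_top[OF tendsto_const]) auto
  then have damp: "(damping \<longlongrightarrow> 0) F"
    unfolding damping_def[abs_def]
    by (intro filterlim_compose[OF exp_at_bot]) (simp add: filterlim_uminus_at_bot)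
  have "((\<lambda>t. amplitude \<beta> t / c * damping t) \<longlongrightarrow> 0) F"
  proof (rule Lim_null_comparison)
    show "\<forall>\<^sub>F t in F. norm (amplitude \<beta> t / c * damping t) \<le> J / c * damping t"
      using t by eventually_elim (use amplitude_term_bound in auto)
    show "((\<lambda>t. J / c * damping t) \<longlongrightarrow> 0) F"
      using tendsto_mult_left[OF damp, of "J / c"] by simp
  qed
  from tendsto_add[OF tendsto_mult_left[OF E, of "1 / 2"] this] show ?thesis
    by (simp add: approx_def[abs_def])
qed

lemma err_tendsto_1: "(err \<longlongrightarrow> 0) (at_left 1)"
proof -
  have ev: "\<forall>\<^sub>F t in at_left 1. \<beta> < t \<and> t < 1"
    using eventually_at_left_real[of \<beta> 1] \<beta>_unit by (auto elim: eventually_mono)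
  note D = rel_ent_at_left_1[OF \<beta>_unit(2)]
  have "filterlim (\<lambda>t. sqrt (real m) * sqrt (rel_ent \<beta> t)) at_top (at_left 1)"
    using m_pos by (intro filterlim_tendsto_pos_mult_at_top[OF tendsto_const]
        filterlim_compose[OF sqrt_at_top D]) auto
  moreover have eq: "\<forall>\<^sub>F t in at_left 1. sqrt (real m) * sqrt (rel_ent \<beta> t) = sqrt (real m) * root_ent \<beta> t"
    using ev by eventually_elim (simp add: root_ent_def)
  ultimately have "filterlim (\<lambda>t. sqrt (real m) * root_ent \<beta> t) at_top (at_left 1)"
    using filterlim_cong[OF refl refl eq] by (simp only:)
  then have "((\<lambda>t. erfc (sqrt (real m) * root_ent \<beta> t)) \<longlongrightarrow> 0) (at_left 1)"
    by (rule filterlim_compose[OF erfc_at_top])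
  then have "(approx \<longlongrightarrow> 0 / 2) (at_left 1)"
    by (rule approx_tendsto[OF D, rotated]) (use ev \<beta>_unit in \<open>auto elim!: eventually_mono\<close>)
  moreover have "(scaled_cdf \<longlongrightarrow> 0) (at_left 1)"
    using scaled_cdf_tendsto[of 1 "{..<1}"] binomial_cdf_1[OF r_bounds(2)] by (simp add: scaled_cdf_def)
  ultimately show ?thesis
    unfolding err_def[abs_def] using tendsto_diff by fastforce
qed

lemma err_tendsto_0: "(err \<longlongrightarrow> 1 - scaled_cdf 0) (at_right 0)"
proof -
  have ev: "\<forall>\<^sub>F t in at_right 0. 0 < t \<and> t < \<beta>"
    using eventually_at_right_real[of 0 \<beta>] \<beta>_unit by (auto elim: eventually_mono)
  note D = rel_ent_at_right_0[OF \<beta>_unit(1)]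
  have "filterlim (\<lambda>t. sqrt (real m) * sqrt (rel_ent \<beta> t)) at_top (at_right 0)"
    using m_pos by (intro filterlim_tendsto_pos_mult_at_top[OF tendsto_const]
        filterlim_compose[OF sqrt_at_top D]) auto
  then have "filterlim (\<lambda>t. - (sqrt (real m) * sqrt (rel_ent \<beta> t))) at_bot (at_right 0)"
    by (simp add: filterlim_uminus_at_bot)
  moreover have eq: "\<forall>\<^sub>F t in at_right 0. - (sqrt (real m) * sqrt (rel_ent \<beta> t)) = sqrt (real m) * root_ent \<beta> t"
    using ev by eventually_elim (simp add: root_ent_def)
  ultimately have "filterlim (\<lambda>t. sqrt (real m) * root_ent \<beta> t) at_bot (at_right 0)"
    using filterlim_cong[OF refl refl eq] by (simp only:)
  then have "((\<lambda>t. erfc (sqrt (real m) * root_ent \<beta> t)) \<longlongrightarrow> 2) (at_right 0)"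
    by (rule filterlim_compose[OF erfc_at_bot])
  then have "(approx \<longlongrightarrow> 2 / 2) (at_right 0)"
    by (rule approx_tendsto[OF D, rotated]) (use ev \<beta>_unit in \<open>auto elim!: eventually_mono\<close>)
  then show ?thesis
    unfolding err_def[abs_def] by (intro tendsto_diff scaled_cdf_tendsto) simp
qed

text \<open>The three sources of error: \<open>\<delta>\<close> is relative to the distribution function and of order \<open>1 / m\<close>, \<open>\<gamma>\<close> is
  the crossing of \<open>t = \<beta>\<close> and of order \<open>1 / sqrt m\<close>, and \<open>\<tau>\<close>, of order \<open>m powr (- 3 / 2)\<close>, is
  accumulated as \<open>t\<close> approaches \<open>0\<close>, where \<open>fisher\<close> is unbounded.\<close>
definition "\<delta> = K / (real m * \<sigma>)"
definition "\<gamma> = J / c"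
definition "\<tau> = K / (c * \<beta> * real m)"

lemma small_nonneg: "0 \<le> \<delta>" "0 \<le> \<gamma>" "0 \<le> \<tau>"
  using K_nonneg J_nonneg m_pos \<sigma>_pos c_pos \<beta>_unit by (simp_all add: \<delta>_def \<gamma>_def \<tau>_def)

lemma err_slope_bound:
  assumes "0 < t" "t < 1" "t \<noteq> \<beta>"
  shows "\<bar>amplitude_slope \<beta> t / c * damping t\<bar> \<le> K * fisher t / c * damping t"
proof -
  have "\<bar>amplitude_slope \<beta> t / c * damping t\<bar> = \<bar>amplitude_slope \<beta> t\<bar> / c * damping t"
    using c_pos damping_pos[of t] by (simp add: abs_mult)
  also have "\<dots> \<le> K * fisher t / c * damping t"
    using slope_bound[OF assms] c_pos damping_pos[of t]
    by (intro mult_right_mono divide_right_mono) auto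
  finally show ?thesis .
qed

lemma cdf_slope_eq:
  assumes "t < 1"
  shows "\<delta> * (real m * (1 - \<beta>) / (c * \<sigma>) * (damping t / (1 - t))) = K / (c * \<beta>) * (damping t / (1 - t))"
proof -
  have "\<delta> * (real m * (1 - \<beta>) / (c * \<sigma>)) = K * (1 - \<beta>) / (c * \<sigma>\<^sup>2)"
    using m_pos by (simp add: \<delta>_def power2_eq_square)
  also have "\<dots> = K / (c * \<beta>)"
    using \<beta>_unit by (simp add: \<sigma>_power2)
  finally show ?thesis
    by (simp only: mult.assoc[symmetric])
qed

text \<open>For \<open>t > \<beta>\<close> the bound \<open>K * fisher t\<close> is at most \<open>K / (\<beta> * (1 - t))\<close>, and \<open>damping t / (1 - t)\<close> is the slope of the
  distribution function up to a factor. So the distribution function itself serves as the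
  budget for the error, starting from \<open>0\<close> at \<open>t = 1\<close>.\<close>
lemma err_right:
  assumes "\<beta> < t" "t < 1"
  shows "\<bar>err t\<bar> \<le> \<delta> * scaled_cdf t"
proof -
  have step: "\<bar>err u - err t\<bar> \<le> - \<delta> * scaled_cdf u - - \<delta> * scaled_cdf t" if u: "t < u" "u < 1" for u
  proof (rule abs_diff_le_of_deriv_le)
    fix x assume "t \<le> x" "x \<le> u"
    then have x: "\<beta> < x" "0 < x" "x < 1" "x \<noteq> \<beta>" using assms u \<beta>_unit by auto
    have "fisher x \<le> 1 / (\<beta> * (1 - x))"
      unfolding fisher_def using x \<beta>_unit by (intro divide_left_mono mult_right_mono) auto
    then have "K * fisher x / c * damping x \<le> K * (1 / (\<beta> * (1 - x))) / c * damping x"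
      using K_nonneg c_pos damping_pos[of x]
      by (intro mult_right_mono divide_right_mono mult_left_mono) auto
    also have "\<dots> = \<delta> * (real m * (1 - \<beta>) / (c * \<sigma>) * (damping x / (1 - x)))"
      unfolding cdf_slope_eq[OF x(3)] by simp
    finally have "\<bar>amplitude_slope \<beta> x / c * damping x\<bar> \<le> - \<delta> * - (real m * (1 - \<beta>) / (c * \<sigma>) * (damping x / (1 - x)))"
      using err_slope_bound[OF x(2-4)] by simp
    then show "\<exists>F' V'. (err has_real_derivative F') (at x) \<and>
        ((\<lambda>x. - \<delta> * scaled_cdf x) has_real_derivative V') (at x) \<and> \<bar>F'\<bar> \<le> V'"
      using err_deriv[OF x(2-4)] DERIV_cmult[OF scaled_cdf_deriv[OF x(2,3)]] by blast
  qed (use u in auto)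
  have ev: "\<forall>\<^sub>F u in at_left 1. \<bar>err u - err t\<bar> \<le> \<delta> * scaled_cdf t"
  proof -
    have "\<forall>\<^sub>F u in at_left 1. t < u \<and> u < 1"
      using eventually_at_left_real[OF assms(2)] by (auto elim: eventually_mono)
    then show ?thesis
    proof eventually_elim
      case (elim u)
      then have "0 \<le> \<delta> * scaled_cdf u"
        using small_nonneg scaled_cdf_pos[of u] assms \<beta>_unit by simp
      then show ?case using step[of u] elim by simp
    qed
  qed
  have "((\<lambda>u. \<bar>err u - err t\<bar>) \<longlongrightarrow> \<bar>0 - err t\<bar>) (at_left 1)"
    by (intro tendsto_intros err_tendsto_1)
  from tendsto_upperbound[OF this ev] show ?thesis by simp
qed

lemma half_erfc_tendsto: "((\<lambda>t. 1 / 2 * erfc (sqrt (real m) * root_ent \<beta> t)) \<longlongrightarrow> 1 / 2) (at \<beta> within S)"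
proof -
  have "(root_ent \<beta> \<longlongrightarrow> 0) (at \<beta> within S)"
    using root_ent_tendsto_0[OF \<beta>_unit] by (rule tendsto_within_subset) simp
  then have "((\<lambda>t. sqrt (real m) * root_ent \<beta> t) \<longlongrightarrow> 0) (at \<beta> within S)"
    by (rule tendsto_mult_right_zero)
  then have "((\<lambda>t. erfc (sqrt (real m) * root_ent \<beta> t)) \<longlongrightarrow> erfc 0) (at \<beta> within S)"
    by (rule isCont_tendsto_compose[OF DERIV_isCont[OF erfc_deriv]])
  from tendsto_mult_left[OF this, of "1 / 2"] show ?thesis
    by (simp add: erfc_0)
qed

lemma err_near:
  assumes "0 < t" "t < 1" "t \<noteq> \<beta>"
  shows "\<bar>err t - (1 / 2 * erfc (sqrt (real m) * root_ent \<beta> t) - scaled_cdf t)\<bar> \<le> \<gamma>"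
proof -
  have "J / c * damping t \<le> \<gamma> * 1"
    unfolding \<gamma>_def[symmetric] using small_nonneg damping_le_1[OF assms(1,2)]
    by (intro mult_left_mono) auto
  then show ?thesis
    using amplitude_term_bound[OF assms] by (simp add: err_def approx_def)
qed

text \<open>At \<open>\<beta>\<close> itself \<open>amplitude\<close> is not available; the bound arises as a limit from the right, where \<open>amplitude\<close>
  enters only through its bound \<open>J\<close>, at a cost of \<open>\<gamma>\<close>.\<close>
lemma err_center: "\<bar>1 / 2 - scaled_cdf \<beta>\<bar> \<le> \<delta> * scaled_cdf \<beta> + \<gamma>"
proof -
  have "((\<lambda>t. \<bar>1 / 2 * erfc (sqrt (real m) * root_ent \<beta> t) - scaled_cdf t\<bar> - \<delta> * scaled_cdf t)
      \<longlongrightarrow> \<bar>1 / 2 - scaled_cdf \<beta>\<bar> - \<delta> * scaled_cdf \<beta>) (at_right \<beta>)"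
    by (intro tendsto_diff tendsto_rabs tendsto_mult_left half_erfc_tendsto scaled_cdf_tendsto)
  moreover have "\<forall>\<^sub>F t in at_right \<beta>.
      \<bar>1 / 2 * erfc (sqrt (real m) * root_ent \<beta> t) - scaled_cdf t\<bar> - \<delta> * scaled_cdf t \<le> \<gamma>"
    using eventually_at_right_real[OF \<beta>_unit(2)]
  proof eventually_elim
    case (elim t)
    then have t: "\<beta> < t" "0 < t" "t < 1" "t \<noteq> \<beta>" using \<beta>_unit by auto
    show ?case
      using err_near[OF t(2-4)] err_right[OF t(1,3)] by linarith
  qed
  ultimately have "\<bar>1 / 2 - scaled_cdf \<beta>\<bar> - \<delta> * scaled_cdf \<beta> \<le> \<gamma>"
    by (rule tendsto_upperbound) simp
  then show ?thesis by simp
qed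

text \<open>For \<open>t < \<beta>\<close> the pole of \<open>fisher\<close> at \<open>0\<close> has to be paid for as well. Writing \<open>1 = t / \<beta> + (\<beta> - t) / \<beta>\<close> splits
  \<open>fisher t\<close> into \<open>1 / (\<beta> * (1 - t))\<close>, charged to the distribution function as before, and
  \<open>(\<beta> - t) * fisher t / \<beta>\<close>, which times \<open>damping t\<close> is a multiple of the derivative of \<open>damping\<close>; the latter
  contributes at most \<open>\<tau>\<close> because \<open>damping\<close> is at most \<open>1\<close>.\<close>
lemma err_left:
  assumes "0 < t" "t < \<beta>"
  shows "\<bar>err t\<bar> \<le> 2 * \<delta> * scaled_cdf t + 2 * \<gamma> + \<tau>"
proof -
  let ?V = "\<lambda>x. - \<delta> * scaled_cdf x + \<tau> * damping x"
  let ?e = "\<lambda>u. 1 / 2 * erfc (sqrt (real m) * root_ent \<beta> u) - scaled_cdf u"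
  have step: "\<bar>err u - err t\<bar> \<le> ?V u - ?V t" if u: "t < u" "u < \<beta>" for u
  proof (rule abs_diff_le_of_deriv_le)
    fix x assume "t \<le> x" "x \<le> u"
    then have x: "x < \<beta>" "0 < x" "x < 1" "x \<noteq> \<beta>" using assms u \<beta>_unit by auto
    have f: "fisher x = 1 / (\<beta> * (1 - x)) - (x - \<beta>) * fisher x / \<beta>"
      using x \<beta>_unit by (simp add: fisher_def divide_simps)
    have "K * fisher x / c * damping x = K / c * damping x * fisher x"
      by simp
    also have "\<dots> = K / c * damping x * (1 / (\<beta> * (1 - x)) - (x - \<beta>) * fisher x / \<beta>)"
      by (rule arg_cong[OF f])
    also have "\<dots> =
        K / (c * \<beta>) * (damping x / (1 - x)) - K / (c * \<beta>) * ((x - \<beta>) * fisher x * damping x)"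
      unfolding right_diff_distrib[of "K / c * damping x"] by (simp add: mult_ac)
    also have "\<dots> = - \<delta> * - (real m * (1 - \<beta>) / (c * \<sigma>) * (damping x / (1 - x)))
        + \<tau> * - (real m * (x - \<beta>) * fisher x * damping x)"
      unfolding cdf_slope_eq[OF x(3), symmetric] using m_pos by (simp add: \<tau>_def)
    finally have "\<bar>amplitude_slope \<beta> x / c * damping x\<bar> \<le> \<dots>"
      using err_slope_bound[OF x(2-4)] by simp
    then show "\<exists>F' V'. (err has_real_derivative F') (at x) \<and>
        (?V has_real_derivative V') (at x) \<and> \<bar>F'\<bar> \<le> V'"
      using err_deriv[OF x(2-4)]
        DERIV_add[OF DERIV_cmult[OF scaled_cdf_deriv[OF x(2,3)], of "- \<delta>"]
          DERIV_cmult[OF damping_deriv[OF x(2,3)], of \<tau>]] by blast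
  qed (use u in auto)
  have ev: "\<forall>\<^sub>F u in at_left \<beta>. \<bar>err t\<bar> - \<bar>?e u\<bar> + \<delta> * scaled_cdf u \<le> \<gamma> + \<tau> + \<delta> * scaled_cdf t"
  proof -
    have "\<forall>\<^sub>F u in at_left \<beta>. t < u \<and> u < \<beta>"
      using eventually_at_left_real[OF assms(2)] by (auto elim: eventually_mono)
    then show ?thesis
    proof eventually_elim
      case (elim u)
      then have u: "0 < u" "u < 1" "u \<noteq> \<beta>" using assms \<beta>_unit by auto
      have "0 \<le> \<tau> * damping t" "\<tau> * damping u \<le> \<tau>"
        using small_nonneg damping_pos[of t] mult_left_mono[OF damping_le_1[OF u(1,2)], of \<tau>] by auto
      then show ?case
        using step[of u] elim err_near[OF u] by simp
    qed
  qed
  have "((\<lambda>u. \<bar>err t\<bar> - \<bar>?e u\<bar> + \<delta> * scaled_cdf u) \<longlongrightarrow>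
      \<bar>err t\<bar> - \<bar>1 / 2 - scaled_cdf \<beta>\<bar> + \<delta> * scaled_cdf \<beta>) (at_left \<beta>)"
    by (intro tendsto_add tendsto_diff tendsto_rabs tendsto_mult_left half_erfc_tendsto
        scaled_cdf_tendsto tendsto_const)
  from tendsto_upperbound[OF this ev]
  have "\<bar>err t\<bar> \<le> \<bar>1 / 2 - scaled_cdf \<beta>\<bar> - \<delta> * scaled_cdf \<beta> + \<gamma> + \<tau> + \<delta> * scaled_cdf t"
    by simp
  then have "\<bar>err t\<bar> \<le> \<delta> * scaled_cdf t + 2 * \<gamma> + \<tau>"
    using err_center by linarith
  moreover have "0 \<le> \<delta> * scaled_cdf t"
    using small_nonneg scaled_cdf_pos[of t] assms \<beta>_unit by simp
  ultimately show ?thesis by linarith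
qed

text \<open>The limit \<open>t = 0\<close> of \<open>err_left\<close> bounds \<open>1 - 1 / stirling_ratio\<close>, since the distribution function is \<open>1\<close> there.
  This removes the normalisation. The absolute errors for \<open>t \<le> \<beta>\<close> become relative ones because the scaled
  distribution function decreases in \<open>t\<close> and is at least \<open>1 / 3\<close> at \<open>\<beta>\<close>.\<close>
lemma relative_error:
  assumes \<epsilon>: "2 * \<delta> + 2 * \<gamma> + \<tau> \<le> \<epsilon>" "\<epsilon> \<le> 1 / 8"
  shows center_error: "\<bar>1 / 2 - binomial_cdf m r \<beta>\<bar> \<le> 16 * \<epsilon> * binomial_cdf m r \<beta>"
    and off_center_error: "0 < t \<Longrightarrow> t < 1 \<Longrightarrow> t \<noteq> \<beta> \<Longrightarrow>
      \<bar>approx t - binomial_cdf m r t\<bar> \<le> 16 * \<epsilon> * binomial_cdf m r t"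
proof -
  let ?M0 = "scaled_cdf 0"
  have eps: "0 \<le> \<epsilon>" "2 * \<delta> \<le> \<epsilon>" "2 * \<gamma> + \<tau> \<le> \<epsilon>"
    using \<epsilon> small_nonneg by linarith+
  have M: "0 < scaled_cdf t" "2 * \<delta> * scaled_cdf t \<le> \<epsilon> * scaled_cdf t"
      "\<epsilon> * scaled_cdf t \<le> 1 / 8 * scaled_cdf t" if "0 \<le> t" "t < 1" for t
    using scaled_cdf_pos[OF that] mult_right_mono[OF eps(2), of "scaled_cdf t"]
      mult_right_mono[OF \<epsilon>(2), of "scaled_cdf t"] by auto
  have M0_err: "\<bar>1 - ?M0\<bar> \<le> \<epsilon> * ?M0 + \<epsilon>"
  proof -
    have "((\<lambda>t. \<bar>err t\<bar> - 2 * \<delta> * scaled_cdf t) \<longlongrightarrow> \<bar>1 - ?M0\<bar> - 2 * \<delta> * ?M0) (at_right 0)"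
      by (intro tendsto_diff tendsto_rabs tendsto_mult_left err_tendsto_0 scaled_cdf_tendsto)
    moreover have "\<forall>\<^sub>F t in at_right 0. \<bar>err t\<bar> - 2 * \<delta> * scaled_cdf t \<le> 2 * \<gamma> + \<tau>"
      using eventually_at_right_real[OF \<beta>_unit(1)]
      by eventually_elim (use err_left in \<open>simp add: algebra_simps\<close>)
    ultimately have "\<bar>1 - ?M0\<bar> - 2 * \<delta> * ?M0 \<le> 2 * \<gamma> + \<tau>"
      by (rule tendsto_upperbound) simp
    then show ?thesis using eps M(2)[of 0] by linarith
  qed
  \<comment> \<open>\<open>?M0\<close> is at most \<open>1 + (?M0 + 1) / 8\<close>\<close>
  then have M0: "?M0 \<le> 9 / 7"
  proof -
    have "\<epsilon> * ?M0 \<le> 1 / 8 * ?M0" by (rule M(3)) auto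
    then show ?thesis using M0_err \<epsilon>(2) by linarith
  qed
  have "\<epsilon> * ?M0 \<le> \<epsilon> * (9 / 7)"
    using M0 eps(1) by (rule mult_left_mono)
  then have M0_err: "\<bar>?M0 - 1\<bar> \<le> 3 * \<epsilon>"
    using M0_err eps(1) by (simp add: abs_minus_commute)
  have transfer: "\<bar>x - binomial_cdf m r t\<bar> \<le> 16 * \<epsilon> * binomial_cdf m r t"
    if x: "\<bar>x - scaled_cdf t\<bar> \<le> 4 * \<epsilon> * scaled_cdf t" and t: "0 \<le> t" "t < 1" for x t
  proof -
    let ?S = "binomial_cdf m r t"
    have S: "0 < ?S" using binomial_cdf_pos[OF t] .
    have scale: "scaled_cdf t = ?S * ?M0"
      by (simp add: scaled_cdf_def binomial_cdf_0)
    have "scaled_cdf t - ?S = ?S * (?M0 - 1)"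
      by (simp add: scale right_diff_distrib)
    then have "\<bar>scaled_cdf t - ?S\<bar> = ?S * \<bar>?M0 - 1\<bar>"
      using S by (simp add: abs_mult)
    also have "\<dots> \<le> ?S * (3 * \<epsilon>)"
      using S M0_err by (intro mult_left_mono) auto
    finally have "\<bar>scaled_cdf t - ?S\<bar> \<le> 3 * (\<epsilon> * ?S)" by (simp add: mult_ac)
    moreover have "\<epsilon> * scaled_cdf t \<le> \<epsilon> * (?S * (9 / 7))"
      unfolding scale using eps(1) S M0 by (intro mult_left_mono) auto
    moreover have "0 \<le> \<epsilon> * ?S" using eps(1) S by simp
    ultimately show ?thesis using x by linarith
  qed
  have center: "\<bar>1 / 2 - scaled_cdf \<beta>\<bar> \<le> \<epsilon> * scaled_cdf \<beta> + \<epsilon>"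
  proof -
    have "0 \<le> \<delta> * scaled_cdf \<beta>"
      using small_nonneg M(1)[of \<beta>] \<beta>_unit by simp
    moreover have "2 * \<delta> * scaled_cdf \<beta> \<le> \<epsilon> * scaled_cdf \<beta>"
      using \<beta>_unit by (intro M(2)) auto
    ultimately show ?thesis
      using err_center eps(3) small_nonneg by linarith
  qed
  then have M\<beta>: "1 / 3 \<le> scaled_cdf \<beta>"
    using M(3)[of \<beta>] \<beta>_unit \<epsilon>(2) by (simp add: abs_le_iff)
  have absorb: "\<epsilon> * scaled_cdf t + \<epsilon> \<le> 4 * \<epsilon> * scaled_cdf t" if "1 / 3 \<le> scaled_cdf t" for t
    using mult_left_mono[OF that eps(1)] by simp
  show "\<bar>1 / 2 - binomial_cdf m r \<beta>\<bar> \<le> 16 * \<epsilon> * binomial_cdf m r \<beta>"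
    using \<beta>_unit by (intro transfer order_trans[OF center absorb[OF M\<beta>]]) auto
  show "\<bar>approx t - binomial_cdf m r t\<bar> \<le> 16 * \<epsilon> * binomial_cdf m r t"
    if t: "0 < t" "t < 1" "t \<noteq> \<beta>"
  proof (rule transfer)
    show "\<bar>approx t - scaled_cdf t\<bar> \<le> 4 * \<epsilon> * scaled_cdf t"
    proof (cases "\<beta> < t")
      case True
      have "0 \<le> \<delta> * scaled_cdf t" "0 \<le> \<epsilon> * scaled_cdf t"
        using small_nonneg eps M(1)[of t] t by auto
      then show ?thesis
        using err_right[OF True t(2)] M(2)[of t] t unfolding err_def by simp
    next
      case False
      then have "t < \<beta>" using t by simp
      have "scaled_cdf \<beta> \<le> scaled_cdf t"
      proof (rule DERIV_nonpos_imp_nonincreasing[where f = scaled_cdf])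
        fix x assume "t \<le> x" "x \<le> \<beta>"
        then have x: "0 < x" "x < 1" using t \<beta>_unit by auto
        have "0 \<le> real m * (1 - \<beta>) / (c * \<sigma>) * (damping x / (1 - x))"
          using m_pos \<beta>_unit c_pos \<sigma>_pos damping_pos[of x] x by simp
        then show "\<exists>y. (scaled_cdf has_real_derivative y) (at x) \<and> y \<le> 0"
          using scaled_cdf_deriv[OF x] by (intro exI conjI) auto
      qed (use False in simp)
      then have "\<epsilon> * scaled_cdf t + \<epsilon> \<le> 4 * \<epsilon> * scaled_cdf t"
        using M\<beta> by (intro absorb) simp
      then show ?thesis
        using err_left[OF t(1) \<open>t < \<beta>\<close>] M(2)[of t] eps t unfolding err_def by linarith
    qed
  qed (use t in auto)
qed

lemma error_scale:
  assumes \<eta>: "0 < \<eta>" "\<eta> \<le> \<beta>" "\<beta> \<le> 1 - \<eta>"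
  shows "2 * \<delta> + 2 * \<gamma> + \<tau> \<le> (3 * K / \<eta> + 2 * J) / sqrt (real m)"
proof -
  have "1 \<le> real m" using m_pos by simp
  then have root: "1 \<le> sqrt (real m)" "sqrt (real m) * 1 \<le> sqrt (real m) * sqrt (real m)"
    by (simp, intro mult_left_mono) auto
  then have sqrt_le: "sqrt (real m) \<le> real m" by simp
  have "real m * 1 \<le> real m * (2 * pi)"
    using pi_gt3 by (intro mult_left_mono) auto
  then have c: "sqrt (real m) \<le> c"
    unfolding c_def by (intro real_sqrt_le_mono) (simp add: algebra_simps)
  have "\<eta> * \<eta> \<le> \<beta> * (1 - \<beta>)"
    using \<eta> by (intro mult_mono) auto
  then have "sqrt (\<eta> * \<eta>) \<le> \<sigma>"
    unfolding \<sigma>_def by (rule real_sqrt_le_mono)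
  then have \<eta>\<sigma>: "\<eta> \<le> \<sigma>" using \<eta> by simp
  have "\<delta> \<le> K / (sqrt (real m) * \<eta>)"
    unfolding \<delta>_def using K_nonneg sqrt_le \<eta>\<sigma> \<eta> root m_pos
    by (intro divide_left_mono mult_mono mult_pos_pos) auto
  moreover have "\<gamma> \<le> J / sqrt (real m)"
    unfolding \<gamma>_def using J_nonneg c c_pos m_pos by (intro divide_left_mono mult_pos_pos) auto
  moreover have "\<tau> \<le> K / (sqrt (real m) * \<eta> * 1)"
    unfolding \<tau>_def using K_nonneg c \<eta> root m_pos c_pos \<open>1 \<le> real m\<close> \<beta>_unit
    by (intro divide_left_mono mult_mono mult_pos_pos) auto
  then have "\<tau> \<le> K / (sqrt (real m) * \<eta>)" by simp
  ultimately have "2 * \<delta> + 2 * \<gamma> + \<tau> \<le>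
      2 * (K / (sqrt (real m) * \<eta>)) + 2 * (J / sqrt (real m)) + K / (sqrt (real m) * \<eta>)"
    by linarith
  also have "\<dots> = (3 * K / \<eta> + 2 * J) / sqrt (real m)"
    using m_pos \<eta> by (simp add: field_simps)
  finally show ?thesis .
qed

end

section \<open>The asymptotic formula\<close>

lemma asymp_equiv_of_relative_error:
  fixes f g :: "nat \<Rightarrow> real"
  assumes "\<forall>\<^sub>F m in sequentially. 0 < g m \<and> \<bar>f m - g m\<bar> \<le> C / sqrt (real m) * g m"
  shows "g \<sim>[sequentially] f"
proof -
  have "(\<lambda>m. f m / g m - 1) \<longlonglongrightarrow> 0"
  proof (rule Lim_null_comparison)
    show "\<forall>\<^sub>F m in sequentially. norm (f m / g m - 1) \<le> C / sqrt (real m)"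
      using assms
    proof eventually_elim
      case (elim m)
      then have "f m / g m - 1 = (f m - g m) / g m"
        by (simp add: diff_divide_distrib)
      then show ?case
        using elim by (simp add: abs_divide divide_le_eq)
    qed
    have "filterlim (\<lambda>m. sqrt (real m)) at_top sequentially"
      by (rule filterlim_compose[OF sqrt_at_top filterlim_real_sequentially])
    then show "(\<lambda>m. C / sqrt (real m)) \<longlonglongrightarrow> 0"
      by (rule real_tendsto_divide_at_top[OF tendsto_const])
  qed
  then have "(\<lambda>m. f m / g m) \<longlonglongrightarrow> 1"
    using LIM_zero_iff by blast
  then have "f \<sim>[sequentially] g"
    by (rule asymp_equivI') 
  then show ?thesis
    by (simp add: asymp_equiv_sym)
qed

text \<open>The case \<open>t = r / m\<close> is included with amplitude \<open>0\<close>: any bounded value would do there, as the term is of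
  order \<open>1 / sqrt m\<close>.\<close>
lemma cdf_uniform_error:
  assumes "0 < \<eta>"
  obtains C where "0 \<le> C"
    "\<And>m r t. \<eta> \<le> real r / real m \<Longrightarrow> real r / real m \<le> 1 - \<eta> \<Longrightarrow> 0 < m \<Longrightarrow>
       C / sqrt (real m) \<le> 1 \<Longrightarrow> 0 < t \<Longrightarrow> t < 1 \<Longrightarrow>
       \<bar>1 / 2 * erfc (sqrt (real m) * root_ent (real r / real m) t)
         + (if t = real r / real m then 0 else amplitude (real r / real m) t) / sqrt (2 * real m * pi)
           * exp (- real m * rel_ent (real r / real m) t) - binomial_cdf m r t\<bar>
       \<le> C / sqrt (real m) * binomial_cdf m r t"
proof -
  obtain K where K: "0 < K"
    "\<And>\<beta> t. \<eta> \<le> \<beta> \<Longrightarrow> \<beta> \<le> 1 - \<eta> \<Longrightarrow> 0 < t \<Longrightarrow> t < 1 \<Longrightarrow> t \<noteq> \<beta> \<Longrightarrow>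
       \<bar>amplitude_slope \<beta> t\<bar> \<le> K * fisher t"
    using amplitude_slope_bound[OF assms] by blast
  obtain J where J: "0 < J"
    "\<And>\<beta> t. \<eta> \<le> \<beta> \<Longrightarrow> \<beta> \<le> 1 - \<eta> \<Longrightarrow> 0 < t \<Longrightarrow> t < 1 \<Longrightarrow> t \<noteq> \<beta> \<Longrightarrow> \<bar>amplitude \<beta> t\<bar> \<le> J"
    using amplitude_bound[OF assms] by blast
  define C where "C = 16 * (3 * K / \<eta> + 2 * J)"
  have C: "0 \<le> C" using K(1) J(1) assms by (simp add: C_def)
  moreover have "\<bar>1 / 2 * erfc (sqrt (real m) * root_ent \<beta> t)
      + (if t = \<beta> then 0 else amplitude \<beta> t) / sqrt (2 * real m * pi)
        * exp (- real m * rel_ent \<beta> t) - binomial_cdf m r t\<bar> \<le> C / sqrt (real m) * binomial_cdf m r t"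
    if \<beta>: "\<eta> \<le> \<beta>" "\<beta> \<le> 1 - \<eta>" "\<beta> = real r / real m" and m: "0 < m" "C / sqrt (real m) \<le> 1"
      and t: "0 < t" "t < 1" for m r \<beta> t
  proof -
    have "0 < real r / real m" "real r / real m < 1"
      using \<beta> assms by auto
    then have r: "0 < r" "r < m"
      using m by (simp_all add: zero_less_divide_iff divide_less_eq)
    interpret binomial_tail m r \<beta> K J
      by unfold_locales (use r \<beta> K J in auto)
    define \<epsilon> where "\<epsilon> = (3 * K / \<eta> + 2 * J) / sqrt (real m)"
    have \<epsilon>: "2 * \<delta> + 2 * \<gamma> + \<tau> \<le> \<epsilon>" "16 * \<epsilon> = C / sqrt (real m)"
      using error_scale[OF assms \<beta>(1,2)] by (simp_all add: \<epsilon>_def C_def)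
    then have \<epsilon>8: "\<epsilon> \<le> 1 / 8"
      using m(2) by simp
    show ?thesis
    proof (cases "t = \<beta>")
      case True
      then show ?thesis
        using center_error[OF \<epsilon>(1) \<epsilon>8] by (simp add: root_ent_def erfc_0 \<epsilon>(2))
    next
      case False
      then show ?thesis
        using off_center_error[OF \<epsilon>(1) \<epsilon>8 t False]
        by (simp add: approx_def damping_def c_def \<epsilon>(2))
    qed
  qed
  ultimately show ?thesis using that by blast
qed

theorem corollary17:
  fixes n :: nat and p a b :: real and r :: "nat \<Rightarrow> nat"
  assumes "n \<ge> 1" and "0 < p" and "p < 1"
    and "0 < a" and "b < 1"
    and "\<forall>\<^sub>F m in sequentially. real (r m) / real m \<in> {a..b}"
  shows "(\<lambda>m. P_correct n m (r m) p) \<sim>[sequentially]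
    (\<lambda>m. (1 / 2 * erfc (sqrt (real m) * \<rho> (real (r m) / real m) (p / (1 - p)))
           + A (real (r m) / real m) (p / (1 - p)) / sqrt (2 * real m * pi)
             * exp (- real m * (\<rho> (real (r m) / real m) (p / (1 - p)))\<^sup>2)) ^ n)"
proof -
  define \<eta> where "\<eta> = min a (1 - b)"
  have \<eta>: "0 < \<eta>" "\<eta> \<le> a" "b \<le> 1 - \<eta>"
    using assms(4,5) by (auto simp: \<eta>_def)
  obtain C where C: "0 \<le> C"
    "\<And>m r t. \<eta> \<le> real r / real m \<Longrightarrow> real r / real m \<le> 1 - \<eta> \<Longrightarrow> 0 < m \<Longrightarrow>
       C / sqrt (real m) \<le> 1 \<Longrightarrow> 0 < t \<Longrightarrow> t < 1 \<Longrightarrow>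
       \<bar>1 / 2 * erfc (sqrt (real m) * root_ent (real r / real m) t)
         + (if t = real r / real m then 0 else amplitude (real r / real m) t) / sqrt (2 * real m * pi)
           * exp (- real m * rel_ent (real r / real m) t) - binomial_cdf m r t\<bar>
       \<le> C / sqrt (real m) * binomial_cdf m r t"
    using cdf_uniform_error[OF \<eta>(1)] by blast
  \<comment> \<open>only \<open>r m / m = p\<close> calls for the value of \<open>A\<close> at its removable singularity, which is then independent of \<open>m\<close>\<close>
  define A0 where "A0 = \<bar>A p (p / (1 - p))\<bar>"
  let ?S = "\<lambda>m. binomial_cdf m (r m) p"
  let ?B = "\<lambda>m. 1 / 2 * erfc (sqrt (real m) * \<rho> (real (r m) / real m) (p / (1 - p)))
      + A (real (r m) / real m) (p / (1 - p)) / sqrt (2 * real m * pi)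
        * exp (- real m * (\<rho> (real (r m) / real m) (p / (1 - p)))\<^sup>2)"
  have "filterlim (\<lambda>m. sqrt (real m)) at_top sequentially"
    by (rule filterlim_compose[OF sqrt_at_top filterlim_real_sequentially])
  then have "\<forall>\<^sub>F m in sequentially. C + 1 \<le> sqrt (real m)"
    by (simp add: filterlim_at_top)
  with assms(6) have "\<forall>\<^sub>F m in sequentially. 0 < ?S m \<and>
      \<bar>?B m - ?S m\<bar> \<le> (C + 4 * A0) / sqrt (real m) * ?S m"
  proof eventually_elim
    case (elim m)
    define \<beta> where "\<beta> = real (r m) / real m"
    have root: "0 < sqrt (real m)" using elim C(1) by linarith
    then have m: "0 < m" by simp
    have small: "C / sqrt (real m) \<le> 1" using elim root by (simp add: divide_le_eq)
    have \<beta>: "\<eta> \<le> \<beta>" "\<beta> \<le> 1 - \<eta>" using elim \<eta> by (auto simp: \<beta>_def)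
    then have \<beta>01: "0 < \<beta>" "\<beta> < 1" using \<eta>(1) by auto
    have S: "0 < ?S m" using assms by (intro binomial_cdf_pos) auto
    note main = C(2)[OF \<beta>[unfolded \<beta>_def] m small assms(2,3), folded \<beta>_def]
    have rho: "\<rho> \<beta> (p / (1 - p)) = root_ent \<beta> p" "(root_ent \<beta> p)\<^sup>2 = rel_ent \<beta> p"
      using rho_odds[OF \<beta>01 assms(2,3)] root_ent_power2[OF \<beta>01 assms(2,3)] .
    have "\<bar>?B m - ?S m\<bar> \<le> (C + 4 * A0) / sqrt (real m) * ?S m"
    proof (cases "p = \<beta>")
      case False
      then have "\<bar>?B m - ?S m\<bar> \<le> C / sqrt (real m) * ?S m"
        using main A_odds[OF \<beta>01 assms(2,3)] unfolding \<beta>_def[symmetric] rho by simp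
      also have "\<dots> \<le> (C + 4 * A0) / sqrt (real m) * ?S m"
        using S root by (intro mult_right_mono divide_right_mono) (auto simp: A0_def)
      finally show ?thesis .
    next
      case True
      have center: "\<bar>1 / 2 - ?S m\<bar> \<le> C / sqrt (real m) * ?S m"
        using main True by (simp add: root_ent_def erfc_0)
      also have "\<dots> \<le> 1 * ?S m"
        using small S by (intro mult_right_mono) auto
      finally have S4: "1 \<le> 4 * ?S m" by linarith
      have "sqrt (real m) \<le> sqrt (2 * real m * pi)"
      proof (rule real_sqrt_le_mono)
        have "real m * 1 \<le> real m * (2 * pi)"
          using pi_gt3 by (intro mult_left_mono) auto
        then show "real m \<le> 2 * real m * pi" by (simp add: mult_ac)
      qed
      then have "\<bar>A \<beta> (p / (1 - p)) / sqrt (2 * real m * pi)\<bar> \<le> A0 / sqrt (real m)"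
        using root True by (auto simp: A0_def intro!: divide_left_mono)
      also have "\<dots> \<le> A0 / sqrt (real m) * (4 * ?S m)"
        using mult_left_mono[OF S4, of "A0 / sqrt (real m)"] root by (simp add: A0_def)
      finally have "\<bar>A \<beta> (p / (1 - p)) / sqrt (2 * real m * pi)\<bar> \<le> A0 / sqrt (real m) * (4 * ?S m)" .
      moreover have "?B m = 1 / 2 + A \<beta> (p / (1 - p)) / sqrt (2 * real m * pi)"
        unfolding \<beta>_def[symmetric] rho using True by (simp add: root_ent_def erfc_0 rel_ent_self)
      ultimately have "\<bar>?B m - ?S m\<bar> \<le> C / sqrt (real m) * ?S m + A0 / sqrt (real m) * (4 * ?S m)"
        using center by linarith
      also have "\<dots> = (C + 4 * A0) / sqrt (real m) * ?S m"
        by (simp add: add_divide_distrib algebra_simps)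
      finally show ?thesis .
    qed
    then show ?case using S by blast
  qed
  then have "?S \<sim>[sequentially] ?B"
    by (rule asymp_equiv_of_relative_error)
  then have "(\<lambda>m. ?S m ^ n) \<sim>[sequentially] (\<lambda>m. ?B m ^ n)"
    by (rule asymp_equiv_power)
  then show ?thesis
    using assms(2,3) by (simp add: P_correct_eq_power)
qed

end
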